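(* For every odd prime $p$, $$\mathcal{E}(G_p)=2p^3-2p^2-p-1+\sqrt{4p^4-4p^2-8p+9}+p\sqrt{p^4-8p+8}.$$ In particular, $\mathcal{E}(G_p)=3p^3+O(p^2)$ as $p\to\infty$ through odd primes.
   Context: For $n\ge2$, $\mathbb{L}_n=\{a+bi+cj+dk: a,b,c,d\in\mathbb{Z}/n\mathbb{Z}\}$ is the ring of Lipschitz quaternions modulo $n$, with the usual relations $i^2=j^2=k^2=-1$, $ij=k=-ji$, $jk=i=-kj$, $ki=j=-ik$ taken modulo $n$. A nonzero element $x$ of a ring is a zero divisor if $xy=0$ or $yx=0$ for some nonzero $y$. $G_n=\Gamma(\mathbb{L}_n)$ is the simple undirected graph whose vertices are the nonzero zero divisors of $\mathbb{L}_n$, distinct $x,y$ being adjacent iff $xy=0$ or $yx=0$. (For odd primes $p$, $\mathbb{L}_p\cong M_2(\mathbb{F}_p)$.) The energy $\mathcal{E}(G)$ of a graph $G$ is the sum of the absolute values of the eigenvalues (with multiplicity) of its adjacency matrix. *)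

theory Defs
  imports
    "HOL-Number_Theory.Number_Theory"
    "HOL-Library.Landau_Symbols"
    "Graph_Theory.Graph_Theory"
    "Jordan_Normal_Form.Spectral_Radius"
begin

text \<open>
  The tuple \<open>(a, b, c, d)\<close> stands for \<open>a + b i + c j + d k\<close>, and the product is the bilinear
  extension of \<open>i\<^sup>2 = j\<^sup>2 = k\<^sup>2 = -1\<close>, \<open>ij = k = -ji\<close>, \<open>jk = i = -kj\<close>, \<open>ki = j = -ik\<close>.
\<close>

type_synonym quat = "int \<times> int \<times> int \<times> int"

fun quat_add :: "quat \<Rightarrow> quat \<Rightarrow> quat" where
  "quat_add (a, b, c, d) (a', b', c', d') = (a + a', b + b', c + c', d + d')"

fun quat_mult :: "quat \<Rightarrow> quat \<Rightarrow> quat" where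
  "quat_mult (a, b, c, d) (a', b', c', d') =
     (a * a' - b * b' - c * c' - d * d',
      a * b' + b * a' + c * d' - d * c',
      a * c' - b * d' + c * a' + d * b',
      a * d' + b * c' - c * b' + d * a')"

fun quat_mod :: "quat \<Rightarrow> int \<Rightarrow> quat" where
  "quat_mod (a, b, c, d) m = (a mod m, b mod m, c mod m, d mod m)"

text \<open>Residue classes modulo \<open>n\<close> are represented by \<open>0, \<dots>, n - 1\<close>.\<close>

definition lipschitz_ring :: "nat \<Rightarrow> quat ring" where
  "lipschitz_ring n =
     \<lparr> carrier = (let Z = carrier (residue_ring (int n)) in Z \<times> Z \<times> Z \<times> Z),
       monoid.mult = (\<lambda>x y. quat_mod (quat_mult x y) (int n)),
       one = (1, 0, 0, 0),
       zero = (0, 0, 0, 0),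
       add = (\<lambda>x y. quat_mod (quat_add x y) (int n)) \<rparr>"

lemma quat_mod_add_left: "quat_mod (quat_add (quat_mod x m) y) m = quat_mod (quat_add x y) m"
  and quat_mod_add_right: "quat_mod (quat_add x (quat_mod y m)) m = quat_mod (quat_add x y) m"
  by (cases x; cases y; simp add: mod_simps)+

lemma quat_mod_mult_left: "quat_mod (quat_mult (quat_mod x m) y) m = quat_mod (quat_mult x y) m"
  and quat_mod_mult_right: "quat_mod (quat_mult x (quat_mod y m)) m = quat_mod (quat_mult x y) m"
  by (cases x; cases y; simp; intro conjI mod_add_cong mod_diff_cong mod_mult_cong; simp)+

lemmas quat_mod_simps =
  quat_mod_add_left quat_mod_add_right quat_mod_mult_left quat_mod_mult_right

lemma ring_lipschitz_ring:
  assumes "n \<ge> 2"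
  shows "ring (lipschitz_ring n)"
proof -
  let ?L = "lipschitz_ring n"
  have m: "carrier (residue_ring (int n)) = {0..<int n}"
    using assms by (auto simp: residue_ring_def)
  have closed: "quat_mod x (int n) \<in> carrier ?L" for x
    using assms by (cases x) (simp add: lipschitz_ring_def m Let_def)
  have ops: "x \<oplus>\<^bsub>?L\<^esub> y = quat_mod (quat_add x y) (int n)"
    "x \<otimes>\<^bsub>?L\<^esub> y = quat_mod (quat_mult x y) (int n)"
    "\<zero>\<^bsub>?L\<^esub> = (0, 0, 0, 0)" "\<one>\<^bsub>?L\<^esub> = (1, 0, 0, 0)" for x y
    by (simp_all add: lipschitz_ring_def)
  have reduced: "quat_mod x (int n) = x" if "x \<in> carrier ?L" for x
    using that by (cases x) (simp add: lipschitz_ring_def m Let_def)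
  have const_closed: "(0, 0, 0, 0) \<in> carrier ?L" "(1, 0, 0, 0) \<in> carrier ?L"
    using assms by (simp_all add: lipschitz_ring_def m Let_def)
  have add_assoc: "quat_add (quat_add x y) z = quat_add x (quat_add y z)" for x y z
    by (cases x; cases y; cases z) simp
  have add_comm: "quat_add x y = quat_add y x" for x y
    by (cases x; cases y) simp
  have add_zero: "quat_add (0, 0, 0, 0) x = x" for x
    by (cases x) simp
  have add_inv: "quat_add (quat_mult (- 1, 0, 0, 0) x) x = (0, 0, 0, 0)" for x
    by (cases x) simp
  have mult_assoc: "quat_mult (quat_mult x y) z = quat_mult x (quat_mult y z)" for x y z
    by (cases x; cases y; cases z) (simp add: algebra_simps)
  have mult_one: "quat_mult (1, 0, 0, 0) x = x" "quat_mult x (1, 0, 0, 0) = x" for x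
    by (cases x; simp)+
  have distrib: "quat_mult (quat_add x y) z = quat_add (quat_mult x z) (quat_mult y z)"
    "quat_mult z (quat_add x y) = quat_add (quat_mult z x) (quat_mult z y)" for x y z
    by (cases x; cases y; cases z; simp add: algebra_simps)+
  show ?thesis
  proof (rule ringI)
    show "abelian_group ?L"
    proof (rule abelian_groupI)
      show "\<exists>y\<in>carrier ?L. y \<oplus>\<^bsub>?L\<^esub> x = \<zero>\<^bsub>?L\<^esub>" for x
        by (intro bexI[of _ "quat_mod (quat_mult (- 1, 0, 0, 0) x) (int n)"])
          (simp_all only: ops closed quat_mod_simps add_inv reduced const_closed)
      show "x \<oplus>\<^bsub>?L\<^esub> y = y \<oplus>\<^bsub>?L\<^esub> x" for x y
        by (simp only: ops add_comm)
    qed (simp_all only: ops closed reduced const_closed quat_mod_simps add_assoc add_zero)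
    show "monoid ?L"
      by (rule monoidI)
        (simp_all only: ops closed reduced const_closed quat_mod_simps mult_assoc mult_one)
  qed (simp_all only: ops quat_mod_simps distrib)
qed

definition zero_divisors :: "('a, 'b) ring_scheme \<Rightarrow> 'a set" where
  "zero_divisors R =
     {x \<in> carrier R. x \<noteq> \<zero>\<^bsub>R\<^esub> \<and>
        (\<exists>y \<in> carrier R. y \<noteq> \<zero>\<^bsub>R\<^esub> \<and> (x \<otimes>\<^bsub>R\<^esub> y = \<zero>\<^bsub>R\<^esub> \<or> y \<otimes>\<^bsub>R\<^esub> x = \<zero>\<^bsub>R\<^esub>))}"

text \<open>An undirected edge is represented by its two arcs.\<close>

definition zero_divisor_graph :: "('a, 'b) ring_scheme \<Rightarrow> 'a pair_pre_digraph" where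
  "zero_divisor_graph R =
     \<lparr> pverts = zero_divisors R,
       parcs = {(x, y). x \<in> zero_divisors R \<and> y \<in> zero_divisors R \<and> x \<noteq> y \<and>
                  (x \<otimes>\<^bsub>R\<^esub> y = \<zero>\<^bsub>R\<^esub> \<or> y \<otimes>\<^bsub>R\<^esub> x = \<zero>\<^bsub>R\<^esub>)} \<rparr>"

lemma pair_graph_zero_divisor_graph:
  assumes "finite (carrier R)"
  shows "pair_graph (zero_divisor_graph R)"
proof -
  have "finite (zero_divisors R)"
    using assms by (rule finite_subset[rotated]) (auto simp: zero_divisors_def)
  moreover have "parcs (zero_divisor_graph R) \<subseteq> zero_divisors R \<times> zero_divisors R"
    by (auto simp: zero_divisor_graph_def)
  ultimately have fin: "finite (parcs (zero_divisor_graph R))"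
    using finite_subset by blast
  show ?thesis
    by unfold_locales
      (use \<open>finite (zero_divisors R)\<close> fin in
        \<open>auto simp: zero_divisor_graph_def arcs_ends_def arc_to_ends_def symmetric_def intro!: symI\<close>)
qed

definition adjacency_mat :: "'a pair_pre_digraph \<Rightarrow> 'a list \<Rightarrow> complex mat" where
  "adjacency_mat G vs =
     mat (length vs) (length vs) (\<lambda>(i, j). if (vs ! i, vs ! j) \<in> parcs G then 1 else 0)"

definition mat_energy :: "complex mat \<Rightarrow> real" where
  "mat_energy A = (\<Sum>\<mu> \<in> spectrum A. real (Polynomial.order \<mu> (char_poly A)) * cmod \<mu>)"

text \<open>
  The adjacency matrix requires an ordering of the vertices; the choice is irrelevant by
  \<open>graph_energy_eq\<close> below. For infinite vertex sets the value is unspecified.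
\<close>

definition graph_energy :: "'a pair_pre_digraph \<Rightarrow> real" where
  "graph_energy G =
     mat_energy (adjacency_mat G (SOME vs. distinct vs \<and> set vs = pverts G))"

lemma char_poly_adjacency_mat_cong:
  assumes "distinct vs" "distinct ws" "set vs = set ws"
  shows "char_poly (adjacency_mat G vs) = char_poly (adjacency_mat G ws)"
proof -
  define n where "n = length vs"
  have "mset ws = mset vs"
    using assms by (simp flip: set_eq_iff_mset_eq_distinct)
  then obtain p where p: "p permutes {..<length vs}" and ws: "permute_list p vs = ws"
    by (rule mset_eq_permutation)
  have pn: "p permutes {0..<n}"
    using p by (simp add: n_def lessThan_atLeast0)
  have len: "length ws = n"
    using ws by (auto simp: n_def)
  have lt: "p i < n \<longleftrightarrow> i < n" for i
    using permutes_in_image[OF pn] by simp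
  have nth: "ws ! i = vs ! p i" if "i < n" for i
    using permute_list_nth[OF p, of i] that ws by (simp add: n_def)
  have inj: "p i = p j \<longleftrightarrow> i = j" for i j
    using permutes_inj[OF pn] by (rule inj_eq)
  define M where "M = char_poly_matrix (adjacency_mat G vs)"
  define N where "N = mat n n (\<lambda>(i, j). M $$ (i, p j))"
  have M: "M \<in> carrier_mat n n"
    by (auto simp: M_def char_poly_matrix_def adjacency_mat_def n_def)
  have N: "N \<in> carrier_mat n n"
    by (simp add: N_def)
  have "char_poly_matrix (adjacency_mat G ws) = mat n n (\<lambda>(i, j). N $$ (p i, j))"
    by (rule eq_matI)
      (auto simp: N_def M_def char_poly_matrix_def adjacency_mat_def len nth lt inj simp flip: n_def)
  hence "det (char_poly_matrix (adjacency_mat G ws)) = signof p * det N"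
    using det_permute_rows[OF N pn] by simp
  also have "det N = det (transpose_mat N)"
    using det_transpose[OF N] by simp
  also have "transpose_mat N = mat n n (\<lambda>(i, j). transpose_mat M $$ (p i, j))"
    by (rule eq_matI) (use M in \<open>auto simp: N_def lt\<close>)
  also have "det \<dots> = signof p * det (transpose_mat M)"
    using M by (intro det_permute_rows[OF _ pn]) auto
  also have "det (transpose_mat M) = det M"
    by (rule det_transpose[OF M])
  also have "signof p * (signof p * det M) = det M"
    by (simp add: sign_def)
  finally show ?thesis
    by (simp add: char_poly_def M_def)
qed

lemma graph_energy_eq:
  assumes "distinct vs" "set vs = pverts G"
  shows "graph_energy G = mat_energy (adjacency_mat G vs)"
proof -
  define ws where "ws = (SOME ws. distinct ws \<and> set ws = pverts G)"
  have ws: "distinct ws \<and> set ws = pverts G"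
    unfolding ws_def by (rule someI[of _ vs]) (use assms in simp)
  hence eq: "char_poly (adjacency_mat G vs) = char_poly (adjacency_mat G ws)"
    using assms by (intro char_poly_adjacency_mat_cong) auto
  have carrier: "adjacency_mat G us \<in> carrier_mat (length us) (length us)" for us
    by (simp add: adjacency_mat_def)
  have "spectrum (adjacency_mat G vs) = spectrum (adjacency_mat G ws)"
    by (simp add: spectrum_root_char_poly[OF carrier] eq)
  thus ?thesis
    by (simp add: graph_energy_def mat_energy_def eq flip: ws_def)
qed

end

theory Submission
  imports Defs
begin

text \<open>
  Since \<open>-1\<close> is a sum of two squares modulo \<open>p\<close>, the quaternions modulo an odd prime are the 2x2
  matrices over the field with \<open>p\<close> elements, and their nonzero zero divisors are the matrices of rank
  one. Such a matrix is determined by its kernel \<open>k\<close> and its image \<open>i\<close>, two arbitrary points of the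
  projective line, and by one of \<open>p - 1\<close> scalars
  (\<open>split_quaternions.bij_betw_zero_divisor_of\<close>). A product \<open>x y\<close> of two of them vanishes iff the
  image of \<open>y\<close> is the kernel of \<open>x\<close>, so the graph depends on the numbers \<open>p + 1\<close> of
  points and \<open>p - 1\<close> of scalars only, and its adjacency operator \<open>A\<close> commutes with all permutations
  of the points.

  The energy is the trace of \<open>\<bar>A\<bar>\<close>. Hence it suffices to know, for every vertex \<open>z\<close>, the value at \<open>z\<close>
  of \<open>\<bar>A\<bar> e\<^sub>z\<close>, where \<open>e\<^sub>z\<close> is the unit vector at \<open>z\<close>; and this is available as soon as \<open>e\<^sub>z\<close> is written
  as a sum of eigenvectors (\<open>graph_energy_eq_sum_abs_at\<close>). No multiplicities, bases or characteristic
  polynomials have to be computed.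

  Functions that are supported on one pair \<open>(k, i)\<close> and sum to zero over the scalars have
  eigenvalue \<open>0\<close> (for \<open>k \<noteq> i\<close>) or \<open>-1\<close> (for \<open>k = i\<close>,
  the matrices of square zero, where the graph lacks the loop). The other functions depend on the
  pair \<open>(k, i)\<close> only, that is, they are square matrices \<open>F\<close> indexed by points. Transposition and the
  permutations of the points split these as follows:
    \<^item> antisymmetric \<open>F\<close> with zero row sums have eigenvalue \<open>p - 1\<close>;
    \<^item> symmetric \<open>F\<close> with zero row sums and zero diagonal have eigenvalue \<open>-(p - 1)\<close>;
    \<^item> \<open>F k i = w k - w i\<close> with \<open>w\<close> of sum zero has eigenvalue \<open>-p (p - 1)\<close>;
    \<^item> \<open>F k i = u k + u i\<close> plus the diagonal matrix of \<open>v\<close>, with \<open>u\<close> and \<open>v\<close> of sum zero, are mapped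
      to the same kind by a 2x2 matrix with eigenvalues
      \<open>(p\<^sup>2 - 2 p \<plusminus> sqrt (p\<^sup>4 - 8 p + 8)) / 2\<close>;
    \<^item> combinations of the constant matrix and the identity are likewise acted on by a 2x2 matrix with
      eigenvalues \<open>(2 p\<^sup>2 - 2 p - 1 \<plusminus> sqrt (4 p\<^sup>4 - 4 p\<^sup>2 - 8 p + 9)) / 2\<close>.
  In the last two cases the eigenvalues have opposite signs, so their absolute values add up to the
  square root; that is where the two radicals of the formula come from.
\<close>

section \<open>Energy as a trace of the absolute value\<close>

text \<open>
  The adjacency operator of a graph on \<open>J\<close>, acting on functions instead of coordinate vectors, so that
  no ordering of the vertices is involved.
\<close>

definition neighbour_sum :: "'a set \<Rightarrow> ('a \<Rightarrow> 'a \<Rightarrow> bool) \<Rightarrow> ('a \<Rightarrow> real) \<Rightarrow> 'a \<Rightarrow> real" where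
  "neighbour_sum J r f x = (\<Sum>y\<in>J. of_bool (r x y) * f y)"

lemma neighbour_sum_cong:
  "(\<And>y. y \<in> J \<Longrightarrow> f y = g y) \<Longrightarrow> neighbour_sum J r f x = neighbour_sum J r g x"
  by (simp add: neighbour_sum_def)

lemma neighbour_sum_lincomb:
  "neighbour_sum J r (\<lambda>y. a * f y + b * g y) x
     = a * neighbour_sum J r f x + b * neighbour_sum J r g x"
  unfolding neighbour_sum_def by (simp add: algebra_simps sum.distrib sum_distrib_left)

lemma neighbour_sum_add:
  "neighbour_sum J r (\<lambda>y. f y + g y) x = neighbour_sum J r f x + neighbour_sum J r g x"
  using neighbour_sum_lincomb[of J r 1 f 1 g x] by simp

lemma neighbour_sum_power_add:
  "(neighbour_sum J r ^^ k) (\<lambda>y. f y + g y) x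
     = (neighbour_sum J r ^^ k) f x + (neighbour_sum J r ^^ k) g x"
proof (induction k arbitrary: x)
  case (Suc k)
  have "(neighbour_sum J r ^^ k) (\<lambda>y. f y + g y)
     = (\<lambda>x. (neighbour_sum J r ^^ k) f x + (neighbour_sum J r ^^ k) g x)"
    using Suc.IH by blast
  then show ?case by (simp add: neighbour_sum_add)
qed simp

lemma neighbour_sum_power_eigen:
  assumes "\<And>x. x \<in> J \<Longrightarrow> neighbour_sum J r f x = l * f x" "x \<in> J"
  shows "(neighbour_sum J r ^^ k) f x = l ^ k * f x"
  using assms(2)
proof (induction k arbitrary: x)
  case (Suc k)
  have "(neighbour_sum J r ^^ Suc k) f x = neighbour_sum J r (\<lambda>y. l ^ k * f y + 0 * f y) x"
    by (simp, rule neighbour_sum_cong) (simp add: Suc.IH)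
  also have "\<dots> = l ^ Suc k * f x"
    unfolding neighbour_sum_lincomb using assms(1)[OF Suc.prems] by simp
  finally show ?case .
qed simp

text \<open>
  The pairs \<open>(f, g)\<close> with \<open>g = \<bar>A\<bar> f\<close> for which this can be certified by writing \<open>f\<close> as a sum of
  eigenvectors. The eigenvector equation is only required on \<open>J\<close>.
\<close>

inductive abs_image for J r where
  eigen: "(\<And>x. x \<in> J \<Longrightarrow> neighbour_sum J r f x = l * f x) \<Longrightarrow> abs_image J r f (\<lambda>x. \<bar>l\<bar> * f x)"
| add: "abs_image J r f g \<Longrightarrow> abs_image J r f' g'
    \<Longrightarrow> abs_image J r (\<lambda>x. f x + f' x) (\<lambda>x. g x + g' x)"

text \<open>
  A polynomial that agrees with the absolute value at the finitely many eigenvalues occurring in a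
  certificate turns \<open>A\<close> into an operator that sends \<open>f\<close> to \<open>g\<close>. Complex polynomials are used because
  the eigenvalues of the adjacency matrix are complex numbers a priori.
\<close>

lemma abs_image_polynomial:
  assumes "abs_image J r f g"
  shows "\<exists>S. finite S \<and> (\<forall>P :: complex poly. (\<forall>l\<in>S. poly P (of_real l) = of_real \<bar>l\<bar>) \<longrightarrow>
    (\<forall>x\<in>J. (\<Sum>k\<le>degree P. coeff P k * of_real ((neighbour_sum J r ^^ k) f x)) = of_real (g x)))"
  using assms
proof induction
  case (eigen f l)
  have "(\<Sum>k\<le>degree P. coeff P k * of_real ((neighbour_sum J r ^^ k) f x)) = of_real (\<bar>l\<bar> * f x)"
    if "poly P (of_real l) = of_real \<bar>l\<bar>" "x \<in> J" for P :: "complex poly" and x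
  proof -
    have "(\<Sum>k\<le>degree P. coeff P k * of_real ((neighbour_sum J r ^^ k) f x))
      = (\<Sum>k\<le>degree P. coeff P k * of_real l ^ k) * of_real (f x)"
      using neighbour_sum_power_eigen[OF eigen that(2)]
      by (simp add: sum_distrib_right mult.assoc)
    then show ?thesis using that(1) by (simp add: poly_altdef)
  qed
  then show ?case by (intro exI[of _ "{l}"]) simp
next
  case (add f g f' g')
  then obtain S S' where S: "finite S"
    "\<And>P x. (\<forall>l\<in>S. poly P (of_real l) = of_real \<bar>l\<bar>) \<Longrightarrow> x\<in>J \<Longrightarrow>
      (\<Sum>k\<le>degree P. coeff P k * of_real ((neighbour_sum J r ^^ k) f x)) = complex_of_real (g x)"
    and S': "finite S'"
    "\<And>P x. (\<forall>l\<in>S'. poly P (of_real l) = of_real \<bar>l\<bar>) \<Longrightarrow> x\<in>J \<Longrightarrow>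
      (\<Sum>k\<le>degree P. coeff P k * of_real ((neighbour_sum J r ^^ k) f' x)) = complex_of_real (g' x)"
    by blast
  show ?case
    by (intro exI[of _ "S \<union> S'"])
      (auto simp: S S' neighbour_sum_power_add distrib_left sum.distrib)
qed

lemma interpolation_exists:
  fixes h :: "'a::field \<Rightarrow> 'a"
  assumes "finite T"
  shows "\<exists>P. \<forall>z\<in>T. poly P z = h z"
  using assms
proof induction
  case (insert t T)
  then obtain P where P: "\<forall>z\<in>T. poly P z = h z" by blast
  define W where "W = (\<Prod>s\<in>T. [:- s, 1:])"
  have W: "poly W z = (\<Prod>s\<in>T. z - s)" for z by (simp add: W_def poly_prod)
  have 1: "poly W t \<noteq> 0" "z \<in> T \<Longrightarrow> poly W z = 0" for z
    using insert.hyps by (auto simp: W)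
  then show ?case using P
    by (intro exI[of _ "P + smult ((h t - poly P t) / poly W t) W"]) simp
qed simp

lemma trace_mult_commute:
  fixes A B :: "'a::comm_semiring_0 mat"
  assumes "A \<in> carrier_mat n n" "B \<in> carrier_mat n n"
  shows "(\<Sum>i<n. (A * B) $$ (i, i)) = (\<Sum>i<n. (B * A) $$ (i, i))"
proof -
  have "(\<Sum>i<n. (X * Y) $$ (i, i)) = (\<Sum>i<n. \<Sum>j<n. X $$ (i, j) * Y $$ (j, i))"
    if "X \<in> carrier_mat n n" "Y \<in> carrier_mat n n" for X Y :: "'a mat"
    using that by (simp add: scalar_prod_def lessThan_atLeast0)
  note e = this
  have "(\<Sum>i<n. (A * B) $$ (i, i)) = (\<Sum>j<n. \<Sum>i<n. A $$ (i, j) * B $$ (j, i))"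
    unfolding e[OF assms] by (rule sum.swap)
  then show ?thesis
    unfolding e[OF assms(2,1)] by (simp add: mult.commute)
qed

lemma upper_triangular_mult:
  fixes A B :: "'a::semiring_0 mat"
  assumes "A \<in> carrier_mat n n" "B \<in> carrier_mat n n" "upper_triangular A" "upper_triangular B"
  shows "upper_triangular (A * B)" "i < n \<Longrightarrow> (A * B) $$ (i, i) = A $$ (i, i) * B $$ (i, i)"
proof -
  have e: "(A * B) $$ (i, j) = (\<Sum>l<n. A $$ (i, l) * B $$ (l, j))" if "i < n" "j < n" for i j
    using that assms(1,2) by (simp add: scalar_prod_def lessThan_atLeast0)
  have z: "A $$ (i, l) * B $$ (l, j) = 0" if "i < n" "l < n" "l < i \<or> j < l" for i j l
    using that assms upper_triangularD[of A l i] upper_triangularD[of B j l] by auto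
  show "upper_triangular (A * B)"
  proof
    fix i j assume "j < i" "i < dim_row (A * B)"
    then show "(A * B) $$ (i, j) = 0"
      using assms(1) by (subst e) (auto intro!: sum.neutral z)
  qed
  assume i: "i < n"
  have "(A * B) $$ (i, i) = (\<Sum>l\<in>{i}. A $$ (i, l) * B $$ (l, i))"
    unfolding e[OF i i] by (rule sum.mono_neutral_right) (use i z[OF i] in \<open>auto simp: neq_iff\<close>)
  then show "(A * B) $$ (i, i) = A $$ (i, i) * B $$ (i, i)" by simp
qed

lemma upper_triangular_power:
  fixes A :: "'a::comm_semiring_1 mat"
  assumes "A \<in> carrier_mat n n" "upper_triangular A"
  shows "upper_triangular (A ^\<^sub>m k) \<and> (\<forall>i<n. (A ^\<^sub>m k) $$ (i, i) = A $$ (i, i) ^ k)"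
proof (induction k)
  case 0
  then show ?case using assms(1) by simp
next
  case (Suc k)
  then show ?case
    using upper_triangular_mult[OF pow_carrier_mat[OF assms(1)] assms(1) _ assms(2)]
    by (simp add: mult.commute)
qed

text \<open>
  By Schur's theorem the matrix is similar to a triangular one, whose diagonal carries the eigenvalues
  and whose powers have the powers of these on their diagonals.
\<close>

lemma trace_power_eq_sum_eigenvalues:
  fixes A :: "complex mat"
  assumes A: "A \<in> carrier_mat n n" and es: "char_poly A = (\<Prod>e\<leftarrow>es. [:- e, 1:])"
  shows "(\<Sum>i<n. (A ^\<^sub>m k) $$ (i, i)) = (\<Sum>e\<leftarrow>es. e ^ k)"
proof -
  obtain B P Q where "schur_decomposition A es = (B, P, Q)" by (cases "schur_decomposition A es")
  from schur_decomposition[OF A es this]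
  have wit: "similar_mat_wit A B P Q" and B: "upper_triangular B" "diag_mat B = es" by auto
  note w = similar_mat_witD2[OF A wit]
  have Bk: "B ^\<^sub>m k \<in> carrier_mat n n" using w by (simp add: pow_carrier_mat)
  have "(\<Sum>i<n. (A ^\<^sub>m k) $$ (i, i)) = (\<Sum>i<n. (P * (B ^\<^sub>m k * Q)) $$ (i, i))"
    unfolding similar_mat_wit_pow_id[OF wit] assoc_mult_mat[OF w(6) Bk w(7)] ..
  also have "\<dots> = (\<Sum>i<n. (B ^\<^sub>m k * Q * P) $$ (i, i))"
    by (rule trace_mult_commute) (use w Bk in auto)
  also have "B ^\<^sub>m k * Q * P = B ^\<^sub>m k * (Q * P)"
    by (rule assoc_mult_mat) (use w Bk in auto)
  also have "\<dots> = B ^\<^sub>m k" using w Bk by simp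
  also have "(\<Sum>i<n. (B ^\<^sub>m k) $$ (i, i)) = (\<Sum>i<n. B $$ (i, i) ^ k)"
    using upper_triangular_power[OF w(5) B(1)] by simp
  also have "\<dots> = (\<Sum>e\<leftarrow>es. e ^ k)"
    using w(5) by (simp add: B(2)[symmetric] diag_mat_def comp_def interv_sum_list_conv_sum_set_nat
        lessThan_atLeast0)
  finally show ?thesis .
qed

lemma order_prod_linear:
  fixes es :: "'a::field list"
  shows "Polynomial.order \<mu> (\<Prod>e\<leftarrow>es. [:- e, 1:]) = count_list es \<mu>"
proof (induction es)
  case (Cons e es)
  have "(\<Prod>e\<leftarrow>es. [:- e, 1:]) \<noteq> 0" by (auto simp: prod_list_zero_iff)
  then show ?case
    using Cons by (simp add: order_mult order_linear' del: mult_pCons_left)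
qed (simp add: order_0I)

lemma sum_list_eq_sum_count_list:
  fixes h :: "'a \<Rightarrow> real"
  assumes "finite S" "set es \<subseteq> S"
  shows "(\<Sum>e\<leftarrow>es. h e) = (\<Sum>x\<in>S. real (count_list es x) * h x)"
  using assms(2)
proof (induction es)
  case (Cons e es)
  have "(\<Sum>x\<in>S. real (count_list (e # es) x) * h x)
      = (\<Sum>x\<in>S. real (count_list es x) * h x + (if e = x then h x else 0))"
    by (intro sum.cong) (auto simp: algebra_simps)
  then show ?case using Cons assms(1) by (simp add: sum.distrib)
qed simp

lemma mat_energy_eq_sum_list:
  assumes "A \<in> carrier_mat n n" "char_poly A = (\<Prod>e\<leftarrow>es. [:- e, 1:])"
  shows "mat_energy A = (\<Sum>e\<leftarrow>es. cmod e)"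
proof -
  have "spectrum A = set es"
    unfolding spectrum_root_char_poly[OF assms(1)] assms(2)
    by (auto simp: poly_prod_list prod_list_zero_iff)
  then show ?thesis
    unfolding mat_energy_def assms(2) order_prod_linear
    using sum_list_eq_sum_count_list[of "set es" es cmod] by simp
qed

lemma abs_image_smult:
  assumes "abs_image J r f g"
  shows "abs_image J r (\<lambda>x. c * f x) (\<lambda>x. c * g x)"
  using assms
proof induction
  case (eigen f l)
  have "neighbour_sum J r (\<lambda>x. c * f x) x = l * (c * f x)" if "x \<in> J" for x
    using neighbour_sum_lincomb[of J r c f 0 f x] eigen[OF that] by simp
  from abs_image.eigen[OF this] show ?case by (simp add: mult.left_commute)
next
  case (add f g f' g')
  from abs_image.add[OF add.IH] show ?case by (simp add: distrib_left)
qed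

text \<open>
  On the span of \<open>f\<close> and \<open>A f\<close> the operator has the eigenvalues \<open>a > 0 > b\<close> with sum \<open>\<tau>\<close> and product
  \<open>-\<kappa>\<close>. The components of \<open>f\<close> are \<open>(A f - b f) / (a - b)\<close> and \<open>(a f - A f) / (a - b)\<close>; weighting them
  with \<open>a\<close> and \<open>-b\<close> gives a formula in which the eigenvalues occur through \<open>\<tau>\<close>, \<open>\<kappa>\<close> and
  \<open>a - b = sqrt (\<tau>\<^sup>2 + 4 \<kappa>)\<close> only.
\<close>

lemma abs_image_quadratic:
  fixes \<tau> \<kappa> :: real
  assumes Af: "\<And>x. x \<in> J \<Longrightarrow> neighbour_sum J r f x = h x"
    and Ah: "\<And>x. x \<in> J \<Longrightarrow> neighbour_sum J r h x = \<tau> * h x + \<kappa> * f x"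
    and "\<kappa> > 0"
  shows "\<exists>f'. abs_image J r f' (\<lambda>x. (\<tau> * h x + 2 * \<kappa> * f x) / sqrt (\<tau>\<^sup>2 + 4 * \<kappa>)) \<and> (\<forall>x\<in>J. f' x = f x)"
proof -
  define D where "D = sqrt (\<tau>\<^sup>2 + 4 * \<kappa>)"
  define a where "a = (\<tau> + D) / 2"
  define b where "b = (\<tau> - D) / 2"
  have D: "D\<^sup>2 = \<tau>\<^sup>2 + 4 * \<kappa>" "D > 0" "\<bar>\<tau>\<bar> < D"
    using \<open>\<kappa> > 0\<close> by (auto simp: D_def intro!: real_less_rsqrt add_nonneg_pos)
  have ab: "a * b = - \<kappa>" "a + b = \<tau>" "a - b = D" "\<bar>a\<bar> = a" "\<bar>b\<bar> = - b"
    using D by (auto simp: a_def b_def power2_eq_square field_simps)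
  have eig: "neighbour_sum J r (\<lambda>x. 1 * h x + (- s) * f x) x = t * (1 * h x + (- s) * f x)"
    if "x \<in> J" "t * s = - \<kappa>" "t + s = \<tau>" for x t s
  proof -
    have "\<tau> = t + s" "\<kappa> = - (t * s)" using that by auto
    then show ?thesis
      unfolding neighbour_sum_lincomb using Af[OF that(1)] Ah[OF that(1)]
      by (simp add: algebra_simps)
  qed
  have 1: "abs_image J r (\<lambda>x. 1 / D * (1 * h x + (- b) * f x)) (\<lambda>x. 1 / D * (\<bar>a\<bar> * (1 * h x + (- b) * f x)))"
    using ab by (intro abs_image_smult abs_image.eigen eig) auto
  have 2: "abs_image J r (\<lambda>x. - 1 / D * (1 * h x + (- a) * f x)) (\<lambda>x. - 1 / D * (\<bar>b\<bar> * (1 * h x + (- a) * f x)))"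
    using ab by (intro abs_image_smult abs_image.eigen eig) (auto simp: mult.commute)
  have e: "1 / D * (\<bar>a\<bar> * (1 * h x + (- b) * f x)) + - 1 / D * (\<bar>b\<bar> * (1 * h x + (- a) * f x))
      = (\<tau> * h x + 2 * \<kappa> * f x) / D" for x
  proof -
    have "\<tau> = a + b" "\<kappa> = - (a * b)" using ab by auto
    then show ?thesis using D(2) unfolding ab(4,5) by (simp add: field_simps)
  qed
  have "1 / D * (1 * h x + (- b) * f x) + - 1 / D * (1 * h x + (- a) * f x) = f x" for x
  proof -
    have "(1 / D * (1 * h x + (- b) * f x) + - 1 / D * (1 * h x + (- a) * f x)) = (a - b) * f x / D"
      by (simp add: diff_divide_distrib algebra_simps)
    then show ?thesis using ab(3) D(2) by simp
  qed
  with abs_image.add[OF 1 2] e show ?thesis unfolding D_def by auto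
qed

text \<open>
  \<open>(\<bar>A\<bar> f) z = c\<close>. Only the diagonal entries of \<open>\<bar>A\<bar>\<close> enter the energy, and values of \<open>f\<close> outside \<open>J\<close> are
  irrelevant, which lets certificates for equal functions on \<open>J\<close> be exchanged.
\<close>

definition abs_at :: "'a set \<Rightarrow> ('a \<Rightarrow> 'a \<Rightarrow> bool) \<Rightarrow> 'a \<Rightarrow> ('a \<Rightarrow> real) \<Rightarrow> real \<Rightarrow> bool" where
  "abs_at J r z f c \<longleftrightarrow> (\<exists>f' g. abs_image J r f' g \<and> (\<forall>x\<in>J. f' x = f x) \<and> g z = c)"

lemma abs_at_cong:
  assumes "abs_at J r z f c" "\<And>x. x \<in> J \<Longrightarrow> f x = f' x" "c = c'"
  shows "abs_at J r z f' c'"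
  using assms unfolding abs_at_def by metis

lemma abs_at_add:
  assumes "abs_at J r z f c" "abs_at J r z f' c'"
  shows "abs_at J r z (\<lambda>x. f x + f' x) (c + c')"
proof -
  obtain F G F' G' where "abs_image J r F G" "\<forall>x\<in>J. F x = f x" "G z = c"
    "abs_image J r F' G'" "\<forall>x\<in>J. F' x = f' x" "G' z = c'"
    using assms unfolding abs_at_def by blast
  then show ?thesis
    unfolding abs_at_def
    by (intro exI[of _ "\<lambda>x. F x + F' x"] exI[of _ "\<lambda>x. G x + G' x"]) (simp add: abs_image.add)
qed

lemma abs_at_eigen:
  assumes "\<And>x. x \<in> J \<Longrightarrow> neighbour_sum J r f x = l * f x"
  shows "abs_at J r z f (\<bar>l\<bar> * f z)"
  unfolding abs_at_def using abs_image.eigen[OF assms] by blast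

lemma abs_at_quadratic:
  assumes "\<And>x. x \<in> J \<Longrightarrow> neighbour_sum J r f x = h x"
    and "\<And>x. x \<in> J \<Longrightarrow> neighbour_sum J r h x = \<tau> * h x + \<kappa> * f x"
    and "\<kappa> > 0"
  shows "abs_at J r z f ((\<tau> * h z + 2 * \<kappa> * f z) / sqrt (\<tau>\<^sup>2 + 4 * \<kappa>))"
  unfolding abs_at_def using abs_image_quadratic[OF assms] by blast

text \<open>
  The energy is the trace of \<open>\<bar>A\<bar>\<close>. Both sides equal the trace of \<open>P(A)\<close> for a polynomial \<open>P\<close> that
  interpolates the absolute value at the eigenvalues of the adjacency matrix and at those in the
  certificates: on the matrix side because the trace of \<open>P(A)\<close> is the sum of \<open>P\<close> over the eigenvalues,
  on the vertex side by \<open>abs_image_polynomial\<close>.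
\<close>

theorem graph_energy_eq_sum_abs_at:
  assumes fin: "finite J" and bij: "bij_betw \<Phi> J (pverts G)"
    and arcs: "\<And>x y. x \<in> J \<Longrightarrow> y \<in> J \<Longrightarrow> r x y \<longleftrightarrow> (\<Phi> x, \<Phi> y) \<in> parcs G"
    and abs_at: "\<And>z. z \<in> J \<Longrightarrow> abs_at J r z (\<lambda>x. of_bool (x = z)) (c z)"
  shows "graph_energy G = (\<Sum>z\<in>J. c z)"
proof -
  obtain xs where xs: "distinct xs" "set xs = J" using finite_distinct_list[OF fin] by blast
  define n where "n = length xs"
  define A where "A = adjacency_mat G (map \<Phi> xs)"
  have in_J: "xs ! i \<in> J" if "i < n" for i using that xs by (auto simp: n_def)
  have bx: "bij_betw (\<lambda>i. xs ! i) {..<n} J"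
    using bij_betw_nth[OF xs(1), of "{..<n}" J] xs(2) by (simp add: n_def)
  have A: "A \<in> carrier_mat n n" by (simp add: A_def adjacency_mat_def n_def)
  have Aij: "A $$ (i, j) = of_bool (r (xs ! i) (xs ! j))" if "i < n" "j < n" for i j
    using that arcs[OF in_J in_J] by (simp add: A_def adjacency_mat_def n_def)
  have energy: "graph_energy G = mat_energy A"
    unfolding A_def using bij xs by (intro graph_energy_eq) (auto simp: distinct_map bij_betw_def)
  obtain es where es: "char_poly A = (\<Prod>e\<leftarrow>es. [:- e, 1:])" using char_poly_factorized[OF A] by blast
  obtain f g where f: "\<And>z. z \<in> J \<Longrightarrow> abs_image J r (f z) (g z)"
    "\<And>z x. z \<in> J \<Longrightarrow> x \<in> J \<Longrightarrow> f z x = of_bool (x = z)"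
    and gz: "\<And>z. z \<in> J \<Longrightarrow> g z z = c z"
    using abs_at unfolding abs_at_def by metis
  have pow: "(A ^\<^sub>m k) $$ (i, j) = of_real ((neighbour_sum J r ^^ k) (f (xs ! j)) (xs ! i))"
    if "i < n" "j < n" for i j k
    using that
  proof (induction k arbitrary: i)
    case 0
    then show ?case
      using xs A f(2)[OF in_J in_J] by (simp add: n_def nth_eq_iff_index_eq)
  next
    case (Suc k)
    have "(A ^\<^sub>m Suc k) = A * A ^\<^sub>m k"
      using A by (induction k) (simp_all add: assoc_mult_mat[of A n n _ n A n])
    then have "(A ^\<^sub>m Suc k) $$ (i, j) = (\<Sum>l<n. A $$ (i, l) * (A ^\<^sub>m k) $$ (l, j))"
      using A Suc.prems pow_carrier_mat[OF A, of k] by (simp add: scalar_prod_def lessThan_atLeast0)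
    also have "\<dots> = of_real (\<Sum>l<n. of_bool (r (xs ! i) (xs ! l)) *
        (neighbour_sum J r ^^ k) (f (xs ! j)) (xs ! l))"
      using Suc by (simp add: Aij)
    also have "\<dots> = of_real (neighbour_sum J r ((neighbour_sum J r ^^ k) (f (xs ! j))) (xs ! i))"
      unfolding neighbour_sum_def by (subst sum.reindex_bij_betw[OF bx]) simp
    finally show ?case by simp
  qed
  have "\<exists>S. \<forall>z\<in>J. finite (S z) \<and> (\<forall>P :: complex poly.
    (\<forall>l\<in>S z. poly P (of_real l) = of_real \<bar>l\<bar>) \<longrightarrow> (\<forall>x\<in>J.
      (\<Sum>k\<le>degree P. coeff P k * of_real ((neighbour_sum J r ^^ k) (f z) x)) = of_real (g z x)))"
    using abs_image_polynomial[OF f(1)] by (intro bchoice) blast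
  then obtain S where S: "\<And>z. z \<in> J \<Longrightarrow> finite (S z)"
    "\<And>z P x. z \<in> J \<Longrightarrow> \<forall>l\<in>S z. poly P (of_real l) = of_real \<bar>l\<bar> \<Longrightarrow> x \<in> J \<Longrightarrow>
      (\<Sum>k\<le>degree P. coeff P k * of_real ((neighbour_sum J r ^^ k) (f z) x)) = complex_of_real (g z x)"
    by blast
  have "finite (set es \<union> (\<Union>z\<in>J. of_real ` S z) :: complex set)"
    using fin S(1) by blast
  from interpolation_exists[OF this, of "\<lambda>z. of_real (cmod z)"]
  obtain P where P: "\<And>e. e \<in> set es \<Longrightarrow> poly P e = of_real (cmod e)"
    "\<And>z l. z \<in> J \<Longrightarrow> l \<in> S z \<Longrightarrow> poly P (of_real l) = of_real \<bar>l\<bar>"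
    by (force simp del: of_real_eq_iff)
  have "complex_of_real (\<Sum>z\<in>J. g z z)
      = (\<Sum>z\<in>J. \<Sum>k\<le>degree P. coeff P k * of_real ((neighbour_sum J r ^^ k) (f z) z))"
    using S(2) P(2) by simp
  also have "\<dots> = (\<Sum>i<n. \<Sum>k\<le>degree P. coeff P k * (A ^\<^sub>m k) $$ (i, i))"
    by (subst sum.reindex_bij_betw[OF bx, symmetric]) (simp add: pow)
  also have "\<dots> = (\<Sum>k\<le>degree P. coeff P k * (\<Sum>i<n. (A ^\<^sub>m k) $$ (i, i)))"
    by (subst sum.swap) (simp add: sum_distrib_left)
  also have "\<dots> = (\<Sum>k\<le>degree P. \<Sum>e\<leftarrow>es. coeff P k * e ^ k)"
    by (simp add: trace_power_eq_sum_eigenvalues[OF A es] sum_list_const_mult)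
  also have "\<dots> = (\<Sum>e\<leftarrow>es. poly P e)"
    unfolding poly_altdef by (induction es) (simp_all add: sum.distrib)
  also have "\<dots> = (\<Sum>e\<leftarrow>es. of_real (cmod e))"
    using P(1) by (metis (mono_tags, lifting) map_eq_conv)
  also have "\<dots> = of_real (\<Sum>e\<leftarrow>es. cmod e)"
    by (induction es) simp_all
  finally have "(\<Sum>z\<in>J. g z z) = (\<Sum>e\<leftarrow>es. cmod e)"
    by (simp only: of_real_eq_iff)
  then have "(\<Sum>z\<in>J. c z) = (\<Sum>e\<leftarrow>es. cmod e)" by (simp add: gz)
  then show ?thesis using energy mat_energy_eq_sum_list[OF A es] by simp
qed

section \<open>Spectral decomposition for pairs of points\<close>

text \<open>
  The abstract form of the zero-divisor graph: a vertex is a triple of a point \<open>k\<close> (the kernel), a point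
  \<open>i\<close> (the image) and a scalar.
\<close>

locale incidence_pattern =
  fixes Pt :: "'b set" and S :: "'c set" and p :: nat
  assumes finite_Pt: "finite Pt" and card_Pt: "card Pt = p + 1"
    and finite_S: "finite S" and card_S: "card S = p - 1"
    and p_ge_3: "p \<ge> 3"
begin

definition J :: "('b \<times> 'b \<times> 'c) set" where "J = Pt \<times> Pt \<times> S"

definition meets :: "'b \<times> 'b \<times> 'c \<Rightarrow> 'b \<times> 'b \<times> 'c \<Rightarrow> bool" where
  "meets x y \<longleftrightarrow> x \<noteq> y \<and> (fst x = fst (snd y) \<or> fst y = fst (snd x))"

definition lift :: "('b \<Rightarrow> 'b \<Rightarrow> real) \<Rightarrow> 'b \<times> 'b \<times> 'c \<Rightarrow> real" where
  "lift F x = F (fst x) (fst (snd x))"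

abbreviation "\<A> \<equiv> neighbour_sum J meets"
abbreviation "\<p> \<equiv> real p"
abbreviation (input) "\<delta> x y \<equiv> of_bool (x = y) :: real"

lemma sum_J: "(\<Sum>y\<in>J. f y) = (\<Sum>k\<in>Pt. \<Sum>i\<in>Pt. \<Sum>s\<in>S. f (k, i, s))"
  unfolding J_def by (simp add: sum.cartesian_product case_prod_unfold)

lemma sum_\<delta>:
  assumes "finite T" "a \<in> T"
  shows "(\<Sum>k\<in>T. \<delta> k a * c k) = c a" "(\<Sum>k\<in>T. \<delta> a k * c k) = c a"
    "(\<Sum>k\<in>T. c k * \<delta> k a) = c a" "(\<Sum>k\<in>T. \<delta> k a) = 1" "(\<Sum>k\<in>T. \<delta> a k) = 1"
proof -
  have "(\<Sum>k\<in>T. of_bool (k = a) * h k) = h a" for h :: "_ \<Rightarrow> real"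
    using sum.delta[OF assms(1), of a h] assms(2)
    by (simp add: of_bool_def if_distrib[of "\<lambda>x. x * _"] cong: if_cong)
  from this[of c] this[of "\<lambda>_. 1"]
  show "(\<Sum>k\<in>T. \<delta> k a * c k) = c a" "(\<Sum>k\<in>T. \<delta> a k * c k) = c a"
    "(\<Sum>k\<in>T. c k * \<delta> k a) = c a" "(\<Sum>k\<in>T. \<delta> k a) = 1" "(\<Sum>k\<in>T. \<delta> a k) = 1"
    by (simp_all only: mult.commute[of "c _"] eq_commute[of a] mult_1_right)
qed

text \<open>
  Inclusion and exclusion over the two ways of being adjacent. The last term removes the loop that the
  condition on points would put at the vertices with \<open>k = i\<close>.
\<close>

lemma adjacency_formula:
  assumes "k \<in> Pt" "i \<in> Pt" "s \<in> S"
  shows "\<A> f (k, i, s) = (\<Sum>a\<in>Pt. \<Sum>t\<in>S. f (a, k, t)) + (\<Sum>a\<in>Pt. \<Sum>t\<in>S. f (i, a, t))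
    - (\<Sum>t\<in>S. f (i, k, t)) - \<delta> k i * f (k, i, s)"
proof -
  have "\<A> f (k, i, s) = (\<Sum>a\<in>Pt. \<Sum>b\<in>Pt. \<Sum>t\<in>S. \<delta> b k * f (a, b, t)) +
      (\<Sum>a\<in>Pt. \<Sum>b\<in>Pt. \<Sum>t\<in>S. \<delta> a i * f (a, b, t)) -
      (\<Sum>a\<in>Pt. \<Sum>b\<in>Pt. \<Sum>t\<in>S. \<delta> a i * (\<delta> b k * f (a, b, t))) -
      (\<Sum>a\<in>Pt. \<Sum>b\<in>Pt. \<Sum>t\<in>S. \<delta> a k * (\<delta> b i * (\<delta> t s * (\<delta> k i * f (a, b, t)))))"
    unfolding neighbour_sum_def sum_J sum.distrib[symmetric] sum_subtractf[symmetric]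
    by (intro sum.cong refl) (auto simp: meets_def)
  also have "(\<Sum>a\<in>Pt. \<Sum>b\<in>Pt. \<Sum>t\<in>S. \<delta> b k * f (a, b, t)) = (\<Sum>a\<in>Pt. \<Sum>t\<in>S. f (a, k, t))"
    by (simp only: sum_distrib_left[symmetric] sum_\<delta>[OF finite_Pt assms(1)])
  also have "(\<Sum>a\<in>Pt. \<Sum>b\<in>Pt. \<Sum>t\<in>S. \<delta> a i * f (a, b, t)) = (\<Sum>a\<in>Pt. \<Sum>t\<in>S. f (i, a, t))"
    by (simp only: sum_distrib_left[symmetric] sum_\<delta>[OF finite_Pt assms(2)])
  also have "(\<Sum>a\<in>Pt. \<Sum>b\<in>Pt. \<Sum>t\<in>S. \<delta> a i * (\<delta> b k * f (a, b, t))) = (\<Sum>t\<in>S. f (i, k, t))"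
    by (simp only: sum_distrib_left[symmetric] sum_\<delta>[OF finite_Pt assms(2)] sum_\<delta>[OF finite_Pt assms(1)])
  also have "(\<Sum>a\<in>Pt. \<Sum>b\<in>Pt. \<Sum>t\<in>S. \<delta> a k * (\<delta> b i * (\<delta> t s * (\<delta> k i * f (a, b, t))))) = \<delta> k i * f (k, i, s)"
    by (simp only: sum_distrib_left[symmetric] sum_\<delta>[OF finite_Pt assms(2)] sum_\<delta>[OF finite_Pt assms(1)]
        sum_\<delta>[OF finite_S assms(3)])
  finally show ?thesis .
qed

lemma real_card: "real (card Pt) = \<p> + 1" "real (card S) = \<p> - 1"
  using p_ge_3 by (auto simp: card_Pt card_S of_nat_diff)

lemma adjacency_lift:
  assumes "k \<in> Pt" "i \<in> Pt" "s \<in> S"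
  shows "\<A> (lift F) (k, i, s) =
    (\<p> - 1) * ((\<Sum>a\<in>Pt. F a k) + (\<Sum>a\<in>Pt. F i a) - F i k) - \<delta> k i * F k i"
  by (simp only: adjacency_formula[OF assms] lift_def fst_conv snd_conv sum_constant real_card
      sum_distrib_left[symmetric] distrib_left right_diff_distrib)

lemma in_J_cases:
  assumes "x \<in> J" obtains k i s where "x = (k, i, s)" "k \<in> Pt" "i \<in> Pt" "s \<in> S"
  using assms by (auto simp: J_def)

lemma abs_at_lift_eigen:
  assumes "\<And>k i. k \<in> Pt \<Longrightarrow> i \<in> Pt \<Longrightarrow>
    (\<p> - 1) * ((\<Sum>a\<in>Pt. F a k) + (\<Sum>a\<in>Pt. F i a) - F i k) - \<delta> k i * F k i = l * F k i"
  shows "abs_at J meets (a, b, t) (lift F) (\<bar>l\<bar> * F a b)"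
proof -
  have "\<A> (lift F) x = l * lift F x" if xJ: "x \<in> J" for x
  proof -
    obtain k i s where x: "x = (k, i, s)" "k \<in> Pt" "i \<in> Pt" "s \<in> S"
      using xJ by (rule in_J_cases)
    show ?thesis
      unfolding x(1) adjacency_lift[OF x(2-4)] assms[OF x(2,3)] by (simp add: lift_def)
  qed
  from abs_at_eigen[OF this, where z = "(a, b, t)"] show ?thesis by (simp add: lift_def)
qed

lemma abs_at_antisymmetric:
  assumes "\<And>k i. k \<in> Pt \<Longrightarrow> i \<in> Pt \<Longrightarrow> F i k = - F k i"
    and "\<And>k. k \<in> Pt \<Longrightarrow> (\<Sum>a\<in>Pt. F a k) = 0"
  shows "abs_at J meets (a, b, t) (lift F) ((\<p> - 1) * F a b)"
proof -
  have row: "(\<Sum>a\<in>Pt. F k a) = 0" if "k \<in> Pt" for k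
    using assms(2)[OF that] sum.cong[OF refl assms(1)[OF _ that], of Pt] by (simp add: sum_negf)
  have diag: "F k k = 0" if "k \<in> Pt" for k using assms(1)[OF that that] by linarith
  have "abs_at J meets (a, b, t) (lift F) (\<bar>\<p> - 1\<bar> * F a b)"
  proof (rule abs_at_lift_eigen)
    fix k i assume ki: "k \<in> Pt" "i \<in> Pt"
    show "(\<p> - 1) * ((\<Sum>a\<in>Pt. F a k) + (\<Sum>a\<in>Pt. F i a) - F i k) - \<delta> k i * F k i = (\<p> - 1) * F k i"
      unfolding assms(2)[OF ki(1)] row[OF ki(2)] assms(1)[OF ki]
      by (cases "k = i") (simp_all add: diag ki)
  qed
  then show ?thesis using p_ge_3 by simp
qed

lemma abs_at_symmetric:
  assumes "\<And>k i. k \<in> Pt \<Longrightarrow> i \<in> Pt \<Longrightarrow> F i k = F k i"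
    and "\<And>k. k \<in> Pt \<Longrightarrow> (\<Sum>a\<in>Pt. F a k) = 0"
    and "\<And>k. k \<in> Pt \<Longrightarrow> F k k = 0"
  shows "abs_at J meets (a, b, t) (lift F) ((\<p> - 1) * F a b)"
proof -
  have row: "(\<Sum>a\<in>Pt. F k a) = 0" if "k \<in> Pt" for k
    using assms(2)[OF that] sum.cong[OF refl assms(1)[OF _ that], of Pt] by simp
  have "abs_at J meets (a, b, t) (lift F) (\<bar>- (\<p> - 1)\<bar> * F a b)"
  proof (rule abs_at_lift_eigen)
    fix k i assume ki: "k \<in> Pt" "i \<in> Pt"
    show "(\<p> - 1) * ((\<Sum>a\<in>Pt. F a k) + (\<Sum>a\<in>Pt. F i a) - F i k) - \<delta> k i * F k i = - (\<p> - 1) * F k i"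
      unfolding assms(2)[OF ki(1)] row[OF ki(2)] assms(1)[OF ki]
      by (cases "k = i") (simp_all add: assms(3) ki algebra_simps)
  qed
  then show ?thesis using p_ge_3 by simp
qed

lemma abs_at_difference:
  assumes "(\<Sum>k\<in>Pt. w k) = 0"
  shows "abs_at J meets (a, b, t) (lift (\<lambda>k i. w k - w i)) (\<p> * (\<p> - 1) * (w a - w b))"
proof -
  have "abs_at J meets (a, b, t) (lift (\<lambda>k i. w k - w i)) (\<bar>- (\<p> * (\<p> - 1))\<bar> * (w a - w b))"
    by (rule abs_at_lift_eigen)
      (simp add: assms sum_subtractf real_card algebra_simps)
  then show ?thesis using p_ge_3 by simp
qed

lemma adjacency_sum_part:
  assumes "(\<Sum>k\<in>Pt. u k) = 0" "(\<Sum>k\<in>Pt. v k) = 0" "x \<in> J"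
  shows "\<A> (lift (\<lambda>k i. u k + u i + \<delta> k i * v k)) x =
    lift (\<lambda>k i. (\<p> - 1) * (\<p> * u k + v k) + (\<p> - 1) * (\<p> * u i + v i)
      + \<delta> k i * (- 2 * u k - \<p> * v k)) x"
proof -
  obtain k i s where x: "x = (k, i, s)" "k \<in> Pt" "i \<in> Pt" "s \<in> S"
    using assms(3) by (rule in_J_cases)
  have "\<A> (lift (\<lambda>k i. u k + u i + \<delta> k i * v k)) x =
    (\<p> - 1) * ((\<p> + 1) * u k + v k + (\<p> + 1) * u i + v i - (u i + u k + \<delta> i k * v i))
      - \<delta> k i * (u k + u i + \<delta> k i * v k)"
    using x by (simp add: adjacency_lift sum.distrib sum_\<delta>[OF finite_Pt] assms(1,2) real_card)
  also have "\<dots> = (\<p> - 1) * (\<p> * u k + v k) + (\<p> - 1) * (\<p> * u i + v i)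
      + \<delta> k i * (- 2 * u k - \<p> * v k)"
    by (cases "k = i") (simp_all add: algebra_simps)
  finally show ?thesis by (simp add: x(1) lift_def)
qed

text \<open>
  The action \<open>(u, v) \<mapsto> ((p - 1) (p u + v), -2 u - p v)\<close> has trace \<open>p\<^sup>2 - 2 p\<close> and determinant
  \<open>-(p - 1) (p\<^sup>2 - 2)\<close>, whence the quadratic relation by the theorem of Cayley and Hamilton.
\<close>

lemma abs_at_sum_part:
  assumes uv: "(\<Sum>k\<in>Pt. u k) = 0" "(\<Sum>k\<in>Pt. v k) = 0"
  shows "abs_at J meets (a, b, t) (lift (\<lambda>k i. u k + u i + \<delta> k i * v k))
    (((\<p>\<^sup>2 - 2 * \<p>) * ((\<p> - 1) * (\<p> * u a + v a) + (\<p> - 1) * (\<p> * u b + v b)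
        + \<delta> a b * (- 2 * u a - \<p> * v a))
      + 2 * ((\<p> - 1) * (\<p>\<^sup>2 - 2)) * (u a + u b + \<delta> a b * v a)) / sqrt (\<p> ^ 4 - 8 * \<p> + 8))"
proof -
  let ?u = "\<lambda>k. (\<p> - 1) * (\<p> * u k + v k)" and ?v = "\<lambda>k. - 2 * u k - \<p> * v k"
  let ?\<tau> = "\<p>\<^sup>2 - 2 * \<p>" and ?\<kappa> = "(\<p> - 1) * (\<p>\<^sup>2 - 2)"
  have s: "(\<Sum>k\<in>Pt. ?u k) = 0" "(\<Sum>k\<in>Pt. ?v k) = 0"
    using uv by (simp_all add: sum.distrib sum_subtractf sum_distrib_left[symmetric] sum_negf)
  have "3 ^ 2 \<le> \<p>\<^sup>2" using p_ge_3 by (intro power_mono) auto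
  then have "?\<kappa> > 0" using p_ge_3 by (intro mult_pos_pos) auto
  moreover have "\<A> (lift (\<lambda>k i. ?u k + ?u i + \<delta> k i * ?v k)) x =
      ?\<tau> * lift (\<lambda>k i. ?u k + ?u i + \<delta> k i * ?v k) x
      + ?\<kappa> * lift (\<lambda>k i. u k + u i + \<delta> k i * v k) x" if "x \<in> J" for x
  proof -
    have "\<A> (lift (\<lambda>k i. ?u k + ?u i + \<delta> k i * ?v k)) x =
      lift (\<lambda>k i. (\<p> - 1) * (\<p> * ?u k + ?v k) + (\<p> - 1) * (\<p> * ?u i + ?v i)
      + \<delta> k i * (- 2 * ?u k - \<p> * ?v k)) x"
      using adjacency_sum_part[OF s that] .
    also have "\<dots> = ?\<tau> * lift (\<lambda>k i. ?u k + ?u i + \<delta> k i * ?v k) x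
      + ?\<kappa> * lift (\<lambda>k i. u k + u i + \<delta> k i * v k) x"
      unfolding lift_def
      by (cases "fst x = fst (snd x)") (simp_all add: algebra_simps power2_eq_square)
    finally show ?thesis .
  qed
  ultimately have "abs_at J meets (a, b, t) (lift (\<lambda>k i. u k + u i + \<delta> k i * v k))
     ((?\<tau> * lift (\<lambda>k i. ?u k + ?u i + \<delta> k i * ?v k) (a, b, t)
      + 2 * ?\<kappa> * lift (\<lambda>k i. u k + u i + \<delta> k i * v k) (a, b, t)) / sqrt (?\<tau>\<^sup>2 + 4 * ?\<kappa>))"
    using adjacency_sum_part[OF uv] by (intro abs_at_quadratic) auto
  moreover have "?\<tau>\<^sup>2 + 4 * ?\<kappa> = \<p> ^ 4 - 8 * \<p> + 8"
    by (simp add: algebra_simps power2_eq_square power4_eq_xxxx)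
  ultimately show ?thesis by (simp only: lift_def fst_conv snd_conv)
qed

lemma adjacency_constant_part:
  assumes "x \<in> J"
  shows "\<A> (lift (\<lambda>k i. c + \<delta> k i * d)) x =
    lift (\<lambda>k i. (\<p> - 1) * ((2 * \<p> + 1) * c + 2 * d) + \<delta> k i * (- c - \<p> * d)) x"
proof -
  obtain k i s where x: "x = (k, i, s)" "k \<in> Pt" "i \<in> Pt" "s \<in> S"
    using assms by (rule in_J_cases)
  have "\<A> (lift (\<lambda>k i. c + \<delta> k i * d)) x =
    (\<p> - 1) * ((\<p> + 1) * c + d + ((\<p> + 1) * c + d) - (c + \<delta> i k * d)) - \<delta> k i * (c + \<delta> k i * d)"
    using x by (simp add: adjacency_lift sum.distrib sum_\<delta>[OF finite_Pt] real_card)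
  also have "\<dots> = (\<p> - 1) * ((2 * \<p> + 1) * c + 2 * d) + \<delta> k i * (- c - \<p> * d)"
    by (cases "k = i") (simp_all add: algebra_simps)
  finally show ?thesis by (simp add: x(1) lift_def)
qed

text \<open>
  As in the previous case, for \<open>(c, d) \<mapsto> ((p - 1) ((2 p + 1) c + 2 d), -c - p d)\<close> of trace
  \<open>2 p\<^sup>2 - 2 p - 1\<close> and determinant \<open>-(p - 1) (2 p\<^sup>2 + p - 2)\<close>.
\<close>

lemma abs_at_constant_part:
  shows "abs_at J meets (a, b, t) (lift (\<lambda>k i. c + \<delta> k i * d))
    (((2 * \<p>\<^sup>2 - 2 * \<p> - 1) * ((\<p> - 1) * ((2 * \<p> + 1) * c + 2 * d) + \<delta> a b * (- c - \<p> * d))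
      + 2 * ((\<p> - 1) * (2 * \<p>\<^sup>2 + \<p> - 2)) * (c + \<delta> a b * d))
     / sqrt (4 * \<p> ^ 4 - 4 * \<p> ^ 2 - 8 * \<p> + 9))"
proof -
  let ?c = "(\<p> - 1) * ((2 * \<p> + 1) * c + 2 * d)" and ?d = "- c - \<p> * d"
  let ?\<tau> = "2 * \<p>\<^sup>2 - 2 * \<p> - 1" and ?\<kappa> = "(\<p> - 1) * (2 * \<p>\<^sup>2 + \<p> - 2)"
  have "3 ^ 2 \<le> \<p>\<^sup>2" using p_ge_3 by (intro power_mono) auto
  then have "?\<kappa> > 0" using p_ge_3 by (intro mult_pos_pos) auto
  moreover have "\<A> (lift (\<lambda>k i. ?c + \<delta> k i * ?d)) x =
      ?\<tau> * lift (\<lambda>k i. ?c + \<delta> k i * ?d) x + ?\<kappa> * lift (\<lambda>k i. c + \<delta> k i * d) x"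
    if "x \<in> J" for x
    unfolding adjacency_constant_part[OF that] lift_def
    by (cases "fst x = fst (snd x)") (simp_all add: algebra_simps power2_eq_square)
  ultimately have "abs_at J meets (a, b, t) (lift (\<lambda>k i. c + \<delta> k i * d))
     ((?\<tau> * lift (\<lambda>k i. ?c + \<delta> k i * ?d) (a, b, t)
      + 2 * ?\<kappa> * lift (\<lambda>k i. c + \<delta> k i * d) (a, b, t)) / sqrt (?\<tau>\<^sup>2 + 4 * ?\<kappa>))"
    using adjacency_constant_part by (intro abs_at_quadratic) auto
  moreover have "?\<tau>\<^sup>2 + 4 * ?\<kappa> = 4 * \<p> ^ 4 - 4 * \<p> ^ 2 - 8 * \<p> + 9"
    by (simp add: algebra_simps power2_eq_square power4_eq_xxxx)
  ultimately show ?thesis by (simp only: lift_def fst_conv snd_conv)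
qed

text \<open>
  Averaging over the scalars splits the unit vector at a vertex into a function of the pair of points
  and a rest with zero average. All sums in \<open>adjacency_formula\<close> vanish for the rest.
\<close>

lemma abs_at_scalar_part:
  assumes z: "a \<in> Pt" "b \<in> Pt" "t \<in> S"
  shows "abs_at J meets (a, b, t) (\<lambda>x. of_bool (x = (a, b, t)) - lift (\<lambda>k i. \<delta> k a * \<delta> i b / (\<p> - 1)) x)
    (\<delta> a b * (1 - 1 / (\<p> - 1)))"
proof -
  let ?f = "\<lambda>x. of_bool (x = (a, b, t)) - lift (\<lambda>k i. \<delta> k a * \<delta> i b / (\<p> - 1)) x :: real"
  have f: "?f (k, i, s) = \<delta> k a * \<delta> i b * (\<delta> s t - 1 / (\<p> - 1))" for k i s
    by (auto simp: lift_def)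
  have 0: "(\<Sum>s\<in>S. ?f (k, i, s)) = 0" for k i
    unfolding f using p_ge_3
    by (simp add: sum_distrib_left[symmetric] sum_subtractf sum_\<delta>[OF finite_S z(3)] real_card)
  have "\<A> ?f x = - \<delta> a b * ?f x" if xJ: "x \<in> J" for x
  proof -
    obtain k i s where x: "x = (k, i, s)" "k \<in> Pt" "i \<in> Pt" "s \<in> S"
      using xJ by (rule in_J_cases)
    show ?thesis
      unfolding x(1) adjacency_formula[OF x(2-4)] 0 unfolding f by auto
  qed
  from abs_at_eigen[OF this, of "(a, b, t)"] show ?thesis by (auto simp: lift_def)
qed

abbreviation "D\<^sub>1 \<equiv> sqrt (4 * \<p> ^ 4 - 4 * \<p> ^ 2 - 8 * \<p> + 9)"
abbreviation "D\<^sub>2 \<equiv> sqrt (\<p> ^ 4 - 8 * \<p> + 8)"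

text \<open>
  The diagonal entries of \<open>\<bar>A\<bar>\<close> at a vertex with equal points (a matrix of square zero) and at one with
  different points. The summands are the contributions of the rational eigenvalues and of the two
  pairs of irrational ones.
\<close>

definition nilpotent_value :: real where
  "nilpotent_value = 1 - 1 / (\<p> - 1)
    + \<p> * (\<p> * (\<p> - 2)\<^sup>2 + 2 * (\<p> - 1) * (\<p>\<^sup>2 - 2)) / ((\<p> + 1) * (\<p> - 1)) / D\<^sub>2
    + ((2 * \<p>\<^sup>2 - 2 * \<p> - 1) * (\<p> - 2) + 2 * (\<p> - 1) * (2 * \<p>\<^sup>2 + \<p> - 2))
      / ((\<p> + 1) * (\<p> - 1)) / D\<^sub>1"

definition regular_value :: real where
  "regular_value = 1 - 2 / (\<p> + 1) - 1 / (\<p> * (\<p> + 1)) + \<p> / (\<p> + 1)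
    + (\<p> * (\<p> - 2)\<^sup>2 + 2 * (\<p>\<^sup>2 - 2)) / (\<p> + 1) / D\<^sub>2
    + ((2 * \<p>\<^sup>2 - 2 * \<p> - 1) * (2 * \<p> - 1) + 2 * (2 * \<p>\<^sup>2 + \<p> - 2))
      / (\<p> * (\<p> + 1)) / D\<^sub>1"

text \<open>
  The averaged unit vector is diagonal here; subtracting from it the multiple of the identity with the
  same trace leaves a diagonal part of sum zero.
\<close>

lemma abs_at_nilpotent:
  assumes "a \<in> Pt" "t \<in> S"
  shows "abs_at J meets (a, a, t) (\<lambda>x. of_bool (x = (a, a, t))) nilpotent_value"
proof -
  let ?v = "\<lambda>k. (\<delta> k a - 1 / (\<p> + 1)) / (\<p> - 1)" and ?d = "1 / ((\<p> + 1) * (\<p> - 1))"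
  have p: "\<p> - 1 \<noteq> 0" "\<p> + 1 \<noteq> 0" using p_ge_3 by auto
  have v: "(\<Sum>k\<in>Pt. ?v k) = 0"
    using p by (simp add: sum_divide_distrib[symmetric] sum_subtractf
        sum_\<delta>[OF finite_Pt assms(1)] real_card)
  have va: "?v a = \<p> / ((\<p> + 1) * (\<p> - 1))" using p by (simp add: divide_simps)
  have "abs_at J meets (a, a, t) (lift (\<lambda>k i. 0 + 0 + \<delta> k i * ?v k))
      (\<p> * (\<p> * (\<p> - 2)\<^sup>2 + 2 * (\<p> - 1) * (\<p>\<^sup>2 - 2)) / ((\<p> + 1) * (\<p> - 1)) / D\<^sub>2)"
  proof (rule abs_at_cong[OF abs_at_sum_part[OF sum.neutral_const v]], goal_cases)
    case 2
    have "(\<p>\<^sup>2 - 2 * \<p>) * (2 * ((\<p> - 1) * x) - \<p> * x) + 2 * ((\<p> - 1) * (\<p>\<^sup>2 - 2)) * x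
        = (\<p> * (\<p> - 2)\<^sup>2 + 2 * (\<p> - 1) * (\<p>\<^sup>2 - 2)) * x" for x
      by (simp add: algebra_simps power2_eq_square)
    from this[of "?v a"] show ?case
      unfolding va by (intro arg_cong[where f = "\<lambda>x. x / D\<^sub>2"]) (simp add: ac_simps)
  qed simp
  moreover have "abs_at J meets (a, a, t) (lift (\<lambda>k i. 0 + \<delta> k i * ?d))
      (((2 * \<p>\<^sup>2 - 2 * \<p> - 1) * (\<p> - 2) + 2 * (\<p> - 1) * (2 * \<p>\<^sup>2 + \<p> - 2))
      / ((\<p> + 1) * (\<p> - 1)) / D\<^sub>1)"
  proof (rule abs_at_cong[OF abs_at_constant_part[of a a t 0 ?d]], goal_cases)
    case 2
    have "(2 * \<p>\<^sup>2 - 2 * \<p> - 1) * ((\<p> - 1) * ((2 * \<p> + 1) * 0 + 2 * x) + \<delta> a a * (- 0 - \<p> * x))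
        + 2 * ((\<p> - 1) * (2 * \<p>\<^sup>2 + \<p> - 2)) * (0 + \<delta> a a * x)
        = ((2 * \<p>\<^sup>2 - 2 * \<p> - 1) * (\<p> - 2) + 2 * (\<p> - 1) * (2 * \<p>\<^sup>2 + \<p> - 2)) * x" for x
      by (simp add: algebra_simps power2_eq_square)
    from this[of ?d] show ?case
      by (intro arg_cong[where f = "\<lambda>x. x / D\<^sub>1"]) simp
  qed simp
  ultimately have parts: "abs_at J meets (a, a, t) (lift (\<lambda>k i. 0 + 0 + \<delta> k i * ?v k))
      (\<p> * (\<p> * (\<p> - 2)\<^sup>2 + 2 * (\<p> - 1) * (\<p>\<^sup>2 - 2)) / ((\<p> + 1) * (\<p> - 1)) / D\<^sub>2)"
    "abs_at J meets (a, a, t) (lift (\<lambda>k i. 0 + \<delta> k i * ?d))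
      (((2 * \<p>\<^sup>2 - 2 * \<p> - 1) * (\<p> - 2) + 2 * (\<p> - 1) * (2 * \<p>\<^sup>2 + \<p> - 2))
      / ((\<p> + 1) * (\<p> - 1)) / D\<^sub>1)" by blast+
  show ?thesis
  proof (rule abs_at_cong[OF abs_at_add[OF abs_at_scalar_part[OF assms(1,1,2)] abs_at_add[OF parts]]],
      goal_cases)
    case (1 x)
    have "\<delta> k a * \<delta> i a / (\<p> - 1) = \<delta> k i * ?v k + \<delta> k i * ?d" for k i
      using p by (auto simp: divide_simps)
    then show ?case by (simp add: lift_def)
  next
    case 2
    show ?case unfolding nilpotent_value_def by simp
  qed
qed

text \<open>
  The averaged unit vector \<open>E\<close> has a single nonzero entry, off the diagonal. Its antisymmetric part is
  split into a difference part, matching its row sums, and a rest \<open>N\<close> with zero row sums. Its symmetric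
  part is split into a sum part, a constant part and a rest \<open>M\<close>; the coefficients of these are forced
  by \<open>M\<close> having zero row sums and zero diagonal.
\<close>

lemma abs_at_regular:
  assumes "a \<in> Pt" "b \<in> Pt" "a \<noteq> b" "t \<in> S"
  shows "abs_at J meets (a, b, t) (\<lambda>x. of_bool (x = (a, b, t))) regular_value"
proof -
  let ?m = "\<p> - 1" and ?q = "\<p> + 1"
  \<comment> \<open>The column sums of \<open>w k - w i\<close> are \<open>- (p + 1) w i\<close>, those of the antisymmetric part are
    \<open>(\<delta> i b - \<delta> i a) / (2 (p - 1))\<close>.\<close>
  let ?w = "\<lambda>k. (\<delta> k a - \<delta> k b) / (2 * ?q * ?m)"
  \<comment> \<open>A zero diagonal forces \<open>v = - 2 u\<close>, so the sum part has row sums \<open>(p + 1) u + v = (p - 1) u\<close>;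
    this explains the square in \<open>u\<close>.\<close>
  let ?u = "\<lambda>k. ((\<delta> k a + \<delta> k b) / 2 - 1 / ?q) / ?m\<^sup>2"
  let ?v = "\<lambda>k. - 2 * ?u k"
  let ?c = "1 / (?q * \<p> * ?m)"
  let ?N = "\<lambda>k i. (\<delta> k a * \<delta> i b - \<delta> k b * \<delta> i a) / (2 * ?m) - (?w k - ?w i)"
  let ?M = "\<lambda>k i. (\<delta> k a * \<delta> i b + \<delta> k b * \<delta> i a) / (2 * ?m)
    - (?u k + ?u i + \<delta> k i * ?v k) - (?c + \<delta> k i * - ?c)"
  have p: "?m \<noteq> 0" "?q \<noteq> 0" "\<p> \<noteq> 0" using p_ge_3 by auto
  note sums = sum_divide_distrib[symmetric] sum_subtractf sum.distrib real_card
    sum_\<delta>[OF finite_Pt assms(1)] sum_\<delta>[OF finite_Pt assms(2)] sum_\<delta>[OF finite_Pt]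
  have w: "(\<Sum>k\<in>Pt. ?w k) = 0" by (simp add: sums)
  have u: "(\<Sum>k\<in>Pt. ?u k) = 0" using p by (simp add: sums)
  have v: "(\<Sum>k\<in>Pt. ?v k) = 0" unfolding sum_distrib_left[symmetric] u by simp
  have N: "(\<Sum>k\<in>Pt. ?N k i) = 0" if "i \<in> Pt" for i
  proof -
    have cancel: "?q * (X / (2 * ?q * ?m)) = X / (2 * ?m)" for X
      using p by (simp add: divide_simps) (simp add: algebra_simps)
    have "(\<Sum>k\<in>Pt. ?N k i) = (\<delta> i b - \<delta> i a) / (2 * ?m) + ?q * ?w i"
      unfolding sum_subtractf w by (simp add: sums)
    also have "?q * ?w i = (\<delta> i a - \<delta> i b) / (2 * ?m)" by (rule cancel)
    finally show ?thesis by (simp flip: add_divide_distrib)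
  qed
  have M: "(\<Sum>k\<in>Pt. ?M k i) = 0" if "i \<in> Pt" for i
  proof -
    have "(\<Sum>k\<in>Pt. ?M k i) = (\<delta> i b + \<delta> i a) / (2 * ?m) - (?q * ?u i + ?v i) - (?q * ?c - ?c)"
      unfolding sum_subtractf sum.distrib u sum_\<delta>[OF finite_Pt that]
      by (simp add: sums)
    also have "?q * ?u i + ?v i = ((\<delta> i a + \<delta> i b) / 2 - 1 / ?q) / ?m"
    proof -
      have "?q * y + - 2 * y = ?m * y" for y by (simp add: algebra_simps)
      then have "?q * ?u i + ?v i = ?m * ?u i" by blast
      also have "?m * (X / ?m\<^sup>2) = X / ?m" for X using p by (simp add: power2_eq_square)
      finally show ?thesis .
    qed
    also have "?q * ?c - ?c = 1 / (?q * ?m)"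
      using p by (simp add: divide_simps)
    also have "(\<delta> i b + \<delta> i a) / (2 * ?m) - ((\<delta> i a + \<delta> i b) / 2 - 1 / ?q) / ?m - 1 / (?q * ?m) = 0"
      by (simp add: diff_divide_distrib add.commute)
    finally show ?thesis .
  qed
  have e: "\<delta> a a = 1" "\<delta> b b = 1" "\<delta> a b = 0" "\<delta> b a = 0" using assms(3) by auto
  have ua: "?u a = 1 / (2 * ?q * ?m)" "?u b = 1 / (2 * ?q * ?m)"
    unfolding e using p by (simp_all add: divide_simps power2_eq_square)
  have diag: "?M k k = 0" for k using assms(3) by (auto simp flip: add_divide_distrib)
  have "abs_at J meets (a, b, t) (lift ?N) (?m * ?N a b)"
    by (rule abs_at_antisymmetric[OF _ N]) (simp_all add: field_simps)
  moreover have "abs_at J meets (a, b, t) (lift ?M) (?m * ?M a b)"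
    by (rule abs_at_symmetric[OF _ M diag]) (simp_all add: field_simps)
  moreover have "abs_at J meets (a, b, t) (lift (\<lambda>k i. ?u k + ?u i + \<delta> k i * ?v k))
      ((\<p> * (\<p> - 2)\<^sup>2 + 2 * (\<p>\<^sup>2 - 2)) / (\<p> + 1) / D\<^sub>2)"
  proof (rule abs_at_cong[OF abs_at_sum_part[OF u v]], goal_cases)
    case 2
    have "(\<p>\<^sup>2 - 2 * \<p>) * (?m * (\<p> * x + - 2 * x) + ?m * (\<p> * x + - 2 * x) + 0 * (- 2 * x - \<p> * (- 2 * x)))
        + 2 * (?m * (\<p>\<^sup>2 - 2)) * (x + x + 0 * (- 2 * x))
        = (\<p> * (\<p> - 2)\<^sup>2 + 2 * (\<p>\<^sup>2 - 2)) * (2 * ?m * x)" for x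
      by (simp add: algebra_simps power2_eq_square)
    note alg = this[of "1 / (2 * ?q * ?m)"]
    have "2 * ?m * (1 / (2 * ?q * ?m)) = 1 / ?q"
      using p by (simp add: divide_simps) (simp add: algebra_simps)
    note alg = alg[unfolded this]
    show ?case
      unfolding ua unfolding e
      by (rule arg_cong[where f = "\<lambda>x. x / D\<^sub>2"]) (rule trans[OF alg], simp)
  qed simp
  moreover have "abs_at J meets (a, b, t) (lift (\<lambda>k i. ?c + \<delta> k i * - ?c))
      (((2 * \<p>\<^sup>2 - 2 * \<p> - 1) * (2 * \<p> - 1) + 2 * (2 * \<p>\<^sup>2 + \<p> - 2))
      / (\<p> * (\<p> + 1)) / D\<^sub>1)"
  proof (rule abs_at_cong[OF abs_at_constant_part[of a b t ?c "- ?c"]], goal_cases)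
    case 2
    have "(2 * \<p>\<^sup>2 - 2 * \<p> - 1) * (?m * ((2 * \<p> + 1) * x + 2 * - x) + 0 * (- x - \<p> * - x))
        + 2 * (?m * (2 * \<p>\<^sup>2 + \<p> - 2)) * (x + 0 * - x)
        = ((2 * \<p>\<^sup>2 - 2 * \<p> - 1) * (2 * \<p> - 1) + 2 * (2 * \<p>\<^sup>2 + \<p> - 2)) * (?m * x)" for x
      by (simp add: algebra_simps power2_eq_square)
    from this[of ?c] show ?case
      unfolding e using p by (intro arg_cong[where f = "\<lambda>x. x / D\<^sub>1"]) (simp add: ac_simps)
  qed simp
  moreover have "?m * ?N a b + (?m * ?M a b + \<p> * ?m * (?w a - ?w b))
     = 1 - 2 / (\<p> + 1) - 1 / (\<p> * (\<p> + 1)) + \<p> / (\<p> + 1)"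
    unfolding ua e using p by (simp add: divide_simps) (simp add: algebra_simps power2_eq_square)
  ultimately have parts: "abs_at J meets (a, b, t) (lift ?N) (?m * ?N a b)"
    "abs_at J meets (a, b, t) (lift ?M) (?m * ?M a b)"
    "abs_at J meets (a, b, t) (lift (\<lambda>k i. ?u k + ?u i + \<delta> k i * ?v k))
      ((\<p> * (\<p> - 2)\<^sup>2 + 2 * (\<p>\<^sup>2 - 2)) / (\<p> + 1) / D\<^sub>2)"
    "abs_at J meets (a, b, t) (lift (\<lambda>k i. ?c + \<delta> k i * - ?c))
      (((2 * \<p>\<^sup>2 - 2 * \<p> - 1) * (2 * \<p> - 1) + 2 * (2 * \<p>\<^sup>2 + \<p> - 2))
      / (\<p> * (\<p> + 1)) / D\<^sub>1)"
    and weight: "?m * ?N a b + (?m * ?M a b + \<p> * ?m * (?w a - ?w b))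
     = 1 - 2 / (\<p> + 1) - 1 / (\<p> * (\<p> + 1)) + \<p> / (\<p> + 1)" by blast+
  show ?thesis
  proof (rule abs_at_cong[OF abs_at_add[OF abs_at_scalar_part[OF assms(1,2,4)]
      abs_at_add[OF abs_at_add[OF parts(1,2)]
      abs_at_add[OF abs_at_difference[OF w] abs_at_add[OF parts(3,4)]]]]], goal_cases)
    case (1 x)
    have "x / m = (x - y) / (2 * m) + (x + y) / (2 * m)" for x y m :: real
      by (simp flip: add_divide_distrib)
    then have "\<delta> k a * \<delta> i b / ?m = (\<delta> k a * \<delta> i b - \<delta> k b * \<delta> i a) / (2 * ?m)
      + (\<delta> k a * \<delta> i b + \<delta> k b * \<delta> i a) / (2 * ?m)" for k i
      by blast
    then show ?case by (simp only: lift_def)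
  next
    case 2
    show ?case unfolding regular_value_def weight[symmetric] e(3)
      by (simp only: add.assoc mult_zero_left add_0_left)
  qed
qed

text \<open>
  There are \<open>(p + 1) (p - 1)\<close> vertices with equal points and \<open>(p + 1) p (p - 1)\<close> others. The numerators
  over a radical add up to a multiple of its radicand, as they must: the two eigenvalues belonging to
  a radical have equal multiplicities (\<open>1\<close> for the constant part, \<open>p\<close> for the sum part), and the
  radical is their difference.
\<close>

lemma total_abs_value:
  "(\<Sum>z\<in>J. if fst z = fst (snd z) then nilpotent_value else regular_value)
    = 2 * \<p> ^ 3 - 2 * \<p> ^ 2 - \<p> - 1 + D\<^sub>1 + \<p> * D\<^sub>2"
proof -
  have p: "\<p> - 1 \<noteq> 0" "\<p> + 1 \<noteq> 0" "\<p> \<noteq> 0" using p_ge_3 by auto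
  have "3 * \<p> \<le> \<p> * \<p>" using p_ge_3 by (intro mult_right_mono) auto
  then have "3 * \<p> \<le> \<p>\<^sup>2" by (simp add: power2_eq_square)
  moreover have "3\<^sup>2 * \<p>\<^sup>2 \<le> \<p>\<^sup>2 * \<p>\<^sup>2"
    using p_ge_3 by (intro mult_right_mono power_mono) auto
  then have "9 * \<p>\<^sup>2 \<le> \<p> ^ 4" by (simp flip: power_add)
  ultimately have D1: "4 * \<p> ^ 4 - 4 * \<p> ^ 2 - 8 * \<p> + 9 > 0"
    and D2: "\<p> ^ 4 - 8 * \<p> + 8 > 0"
    using p_ge_3 by linarith+
  have e1: "(\<p> + 1) * (\<p> - 1) * (1 - 1 / (\<p> - 1)) = (\<p> + 1) * (\<p> - 2)"
    using p by (simp add: field_simps)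
  have e2: "(\<p> + 1) * (\<p> - 1) * (X / ((\<p> + 1) * (\<p> - 1)) / d) = X / d" for X d
    using p by simp
  have e3: "(\<p> + 1) * \<p> * (\<p> - 1) * (1 - 2 / (\<p> + 1) - 1 / (\<p> * (\<p> + 1)) + \<p> / (\<p> + 1))
      = (\<p> - 1) * (\<p> * (2 * \<p> - 1) - 1)"
    using p by (simp add: divide_simps) (simp add: algebra_simps power2_eq_square)
  have e4: "(\<p> + 1) * \<p> * (\<p> - 1) * (X / (\<p> + 1) / d) = \<p> * (\<p> - 1) * X / d" for X d
    using p by simp
  have e5: "(\<p> + 1) * \<p> * (\<p> - 1) * (X / (\<p> * (\<p> + 1)) / d) = (\<p> - 1) * X / d" for X d
    using p by simp
  have dist: "c * (x + y + z) = c * x + c * y + c * z" for c x y z :: real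
    by (simp add: algebra_simps)
  have e6: "\<p> * (\<p> ^ 4 - 8 * \<p> + 8) = \<p> * (\<p> * (\<p> - 2)\<^sup>2 + 2 * (\<p> - 1) * (\<p>\<^sup>2 - 2))
      + \<p> * (\<p> - 1) * (\<p> * (\<p> - 2)\<^sup>2 + 2 * (\<p>\<^sup>2 - 2))"
    by (simp add: algebra_simps power2_eq_square power4_eq_xxxx)
  have e7: "4 * \<p> ^ 4 - 4 * \<p> ^ 2 - 8 * \<p> + 9
    = ((2 * \<p>\<^sup>2 - 2 * \<p> - 1) * (\<p> - 2) + 2 * (\<p> - 1) * (2 * \<p>\<^sup>2 + \<p> - 2))
      + (\<p> - 1) * ((2 * \<p>\<^sup>2 - 2 * \<p> - 1) * (2 * \<p> - 1) + 2 * (2 * \<p>\<^sup>2 + \<p> - 2))"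
    by (simp add: algebra_simps power2_eq_square power4_eq_xxxx)
  have "(\<Sum>z\<in>J. if fst z = fst (snd z) then nilpotent_value else regular_value)
    = (\<Sum>k\<in>Pt. \<Sum>i\<in>Pt. \<Sum>s\<in>S. regular_value + \<delta> k i * (nilpotent_value - regular_value))"
    unfolding sum_J by (intro sum.cong) auto
  also have "\<dots> = (\<p> + 1) * ((\<p> - 1) * ((\<p> + 1) * regular_value + (nilpotent_value - regular_value)))"
    by (simp add: sum.distrib real_card sum_distrib_left[symmetric] sum_\<delta>[OF finite_Pt])
  also have "\<dots> = (\<p> + 1) * (\<p> - 1) * nilpotent_value + (\<p> + 1) * \<p> * (\<p> - 1) * regular_value"
    by (simp add: algebra_simps)
  also have "\<dots> = (\<p> + 1) * (\<p> - 2) + (\<p> - 1) * (\<p> * (2 * \<p> - 1) - 1)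
    + \<p> * (\<p> ^ 4 - 8 * \<p> + 8) / D\<^sub>2 + (4 * \<p> ^ 4 - 4 * \<p> ^ 2 - 8 * \<p> + 9) / D\<^sub>1"
    (is "?L = ?s + ?t + ?X / ?d2 + ?Y / ?d1")
  proof -
    let ?X = "\<p> * (\<p> * (\<p> - 2)\<^sup>2 + 2 * (\<p> - 1) * (\<p>\<^sup>2 - 2))"
    let ?X' = "\<p> * (\<p> - 1) * (\<p> * (\<p> - 2)\<^sup>2 + 2 * (\<p>\<^sup>2 - 2))"
    let ?Y = "(2 * \<p>\<^sup>2 - 2 * \<p> - 1) * (\<p> - 2) + 2 * (\<p> - 1) * (2 * \<p>\<^sup>2 + \<p> - 2)"
    let ?Y' = "(\<p> - 1) * ((2 * \<p>\<^sup>2 - 2 * \<p> - 1) * (2 * \<p> - 1) + 2 * (2 * \<p>\<^sup>2 + \<p> - 2))"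
    have "(\<p> + 1) * (\<p> - 1) * nilpotent_value = ?s + ?X / ?d2 + ?Y / ?d1"
      unfolding nilpotent_value_def by (simp only: dist[of "(\<p> + 1) * (\<p> - 1)"] e1 e2)
    moreover have "(\<p> + 1) * \<p> * (\<p> - 1) * regular_value = ?t + ?X' / ?d2 + ?Y' / ?d1"
      unfolding regular_value_def by (subst dist[of "(\<p> + 1) * \<p> * (\<p> - 1)"]) (simp only: e3 e4 e5)
    moreover have "s + x / d + y / e + (t + x' / d + y' / e) = s + t + (x + x') / d + (y + y') / e"
      for s t x x' y y' d e :: real
      by (simp add: add_divide_distrib)
    ultimately show ?thesis by (simp only: e6 e7)
  qed
  also have "\<dots> = 2 * \<p> ^ 3 - 2 * \<p> ^ 2 - \<p> - 1 + D\<^sub>1 + \<p> * D\<^sub>2"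
    unfolding times_divide_eq_right[symmetric]
      real_div_sqrt[OF less_imp_le[OF D1]] real_div_sqrt[OF less_imp_le[OF D2]]
    by (simp add: algebra_simps power2_eq_square power3_eq_cube)
  finally show ?thesis .
qed

end

section \<open>Zero divisors of the quaternions modulo an odd prime\<close>

text \<open>
  Pigeonhole: \<open>x\<^sup>2\<close> and \<open>-1 - y\<^sup>2\<close> both take \<open>(p + 1) / 2\<close> of the \<open>p\<close> values modulo \<open>p\<close>, so they
  share one.
\<close>

lemma sum_two_squares_cong_minus_one:
  assumes "prime p" "odd (p :: nat)"
  shows "\<exists>\<alpha> \<beta> :: int. int p dvd \<alpha>\<^sup>2 + \<beta>\<^sup>2 + 1"
proof -
  let ?P = "int p"
  define H where "H = {0..?P div 2}"
  have P: "prime ?P" "?P > 0" using assms by (auto simp: prime_gt_0_nat)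
  have odd: "?P = 2 * (?P div 2) + 1" using assms(2) by presburger
  have cong: "x = y" if "x \<in> H" "y \<in> H" "?P dvd x\<^sup>2 - y\<^sup>2" for x y
  proof -
    have "?P dvd (x - y) * (x + y)"
      using that(3) by (simp add: power2_eq_square algebra_simps)
    then have "?P dvd x - y \<or> ?P dvd x + y" using P(1) prime_dvd_mult_iff by blast
    then show ?thesis
    proof
      assume "?P dvd x - y"
      then have "x mod ?P = y mod ?P" by (simp add: mod_eq_dvd_iff)
      moreover have "0 \<le> x" "x < ?P" "0 \<le> y" "y < ?P" using that(1,2) odd by (auto simp: H_def)
      ultimately show ?thesis by simp
    next
      assume "?P dvd x + y"
      moreover have "0 \<le> x + y" "x + y < ?P" using that(1,2) odd by (auto simp: H_def)
      ultimately have "x + y = 0" using zdvd_not_zless[of "x + y" ?P] by linarith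
      then show ?thesis using that(1,2) by (auto simp: H_def)
    qed
  qed
  define f where "f = (\<lambda>x. x\<^sup>2 mod ?P)"
  define g where "g = (\<lambda>y. (- 1 - y\<^sup>2) mod ?P)"
  have f: "inj_on f H"
    by (rule inj_onI, rule cong) (auto simp: f_def mod_eq_dvd_iff)
  have g: "inj_on g H"
  proof (rule inj_onI)
    fix x y assume xy: "x \<in> H" "y \<in> H" "g x = g y"
    then have "?P dvd y\<^sup>2 - x\<^sup>2" by (simp add: g_def mod_eq_dvd_iff)
    from cong[OF xy(2,1) this] show "x = y" ..
  qed
  have "f ` H \<inter> g ` H \<noteq> {}"
  proof
    assume disj: "f ` H \<inter> g ` H = {}"
    have "card (f ` H \<union> g ` H) = card H + card H"
      using f g disj by (subst card_Un_disjoint) (auto simp: card_image H_def)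
    moreover have "card (f ` H \<union> g ` H) \<le> card {0..<?P}"
      using P(2) by (intro card_mono) (auto simp: f_def g_def)
    moreover have "int (card H) = ?P div 2 + 1" using P(2) by (simp add: H_def)
    ultimately show False using odd by simp
  qed
  then obtain x y where "f x = g y" by blast
  then have "?P dvd x\<^sup>2 + y\<^sup>2 + 1" by (simp add: f_def g_def mod_eq_dvd_iff algebra_simps)
  then show ?thesis by blast
qed

lemma quat_mod_eq_iff:
  "quat_mod (a, b, c, d) m = quat_mod (a', b', c', d') m \<longleftrightarrow>
     m dvd a - a' \<and> m dvd b - b' \<and> m dvd c - c' \<and> m dvd d - d'"
  by (simp add: mod_eq_dvd_iff)

lemma quat_mod_mod: "quat_mod (quat_mod x m) m = quat_mod x m"
  by (cases x) simp

text \<open>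
  Here a quadruple is a 2x2 matrix, read row by row.
\<close>

fun mat2_mult :: "quat \<Rightarrow> quat \<Rightarrow> quat" where
  "mat2_mult (a, b, c, d) (a', b', c', d') =
     (a * a' + b * c', a * b' + b * d', c * a' + d * c', c * b' + d * d')"

lemma quat_mod_mat2_mult:
  "quat_mod (mat2_mult (quat_mod x m) (quat_mod y m)) m = quat_mod (mat2_mult x y) m"
  by (cases x; cases y; simp; intro conjI mod_add_cong mod_mult_cong; simp)

text \<open>
  A solution of \<open>\<alpha>\<^sup>2 + \<beta>\<^sup>2 = -1\<close> splits the quaternions: \<open>i\<close> and \<open>j\<close> are represented by the matrices with
  rows \<open>(\<alpha>, \<beta>), (\<beta>, -\<alpha>)\<close> and \<open>(0, -1), (1, 0)\<close>.
\<close>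

locale split_quaternions =
  fixes p :: nat and \<alpha> \<beta> :: int
  assumes prime: "prime p" and odd: "odd p" and \<alpha>\<beta>: "int p dvd \<alpha>\<^sup>2 + \<beta>\<^sup>2 + 1"
begin

abbreviation "P \<equiv> int p"
abbreviation "red x \<equiv> quat_mod x P"

text \<open>
  The inverse of 2 modulo \<open>p\<close>, which is needed to solve for the quaternion with a given matrix.
\<close>

definition half :: int where "half = (P + 1) div 2"

fun to_mat :: "quat \<Rightarrow> quat" where
  "to_mat (a, b, c, d) =
     (a + \<alpha> * b + \<beta> * d, \<beta> * b - c - \<alpha> * d, \<beta> * b + c - \<alpha> * d, a - \<alpha> * b - \<beta> * d)"

fun of_mat :: "quat \<Rightarrow> quat" where
  "of_mat (a, b, c, d) =
     (half * (a + d), - half * (\<alpha> * (a - d) + \<beta> * (b + c)), half * (c - b),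
      - half * (\<beta> * (a - d) - \<alpha> * (b + c)))"

lemma P_eq: "P = 2 * half - 1" and P_prime: "prime P" and P_ge_3: "P \<ge> 3"
proof -
  have "odd P" using odd by simp
  then show "P = 2 * half - 1" unfolding half_def by presburger
  show "prime P" using prime by simp
  have "p \<noteq> 2" using odd by auto
  then show "P \<ge> 3" using prime_ge_2_nat[OF prime] by simp
qed

lemma red_to_mat_red: "red (to_mat (red x)) = red (to_mat x)"
  by (cases x; simp; intro conjI mod_add_cong mod_diff_cong mod_mult_cong; simp)

lemma red_of_mat_red: "red (of_mat (red x)) = red (of_mat x)"
  by (cases x; simp; intro conjI mod_add_cong mod_diff_cong mod_mult_cong mod_minus_cong; simp)

text \<open>
  The entries of the two sides differ by multiples of \<open>\<alpha>\<^sup>2 + \<beta>\<^sup>2 + 1\<close>.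
\<close>

lemma to_mat_mult: "red (to_mat (quat_mult x y)) = red (mat2_mult (to_mat x) (to_mat y))"
proof -
  obtain a b c d a' b' c' d' where x: "x = (a, b, c, d)" "y = (a', b', c', d')"
    by (cases x; cases y) auto
  have 1: "P dvd z" if "z = (\<alpha> * \<alpha> + \<beta> * \<beta> + 1) * t" for z t
    using that \<alpha>\<beta> by (simp add: power2_eq_square)
  show ?thesis
    unfolding x quat_mult.simps to_mat.simps mat2_mult.simps quat_mod_eq_iff
    by (intro conjI)
      (rule 1[of _ "- (b * b' + d * d')"] 1[of _ "b * d' - d * b'"] 1[of _ "d * b' - b * d'"],
        simp add: algebra_simps; fail)+
qed

lemma of_mat_to_mat: "red (of_mat (to_mat x)) = red x"
proof -
  obtain a b c d where x: "x = (a, b, c, d)" by (cases x) auto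
  obtain e where e: "\<alpha> * \<alpha> + \<beta> * \<beta> + 1 = (2 * half - 1) * e"
    using \<alpha>\<beta> P_eq by (auto simp: power2_eq_square)
  have 1: "2 * half - 1 dvd z" if "z = (2 * half - 1) * t" for z t using that by simp
  have r: "- half * (2 * ((\<alpha> * \<alpha> + \<beta> * \<beta>) * z)) - z = (2 * half - 1) * (z - 2 * half * e * z)" for z
  proof -
    have N: "\<alpha> * \<alpha> + \<beta> * \<beta> = (2 * half - 1) * e - 1" using e by simp
    show ?thesis unfolding N by (simp add: algebra_simps)
  qed
  show ?thesis
    unfolding x to_mat.simps of_mat.simps quat_mod_eq_iff P_eq
  proof (intro conjI)
    show "2 * half - 1 dvd half * (a + \<alpha> * b + \<beta> * d + (a - \<alpha> * b - \<beta> * d)) - a"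
      by (rule 1[of _ a]) (simp add: algebra_simps)
    show "2 * half - 1 dvd half * (\<beta> * b + c - \<alpha> * d - (\<beta> * b - c - \<alpha> * d)) - c"
      by (rule 1[of _ c]) (simp add: algebra_simps)
    show "2 * half - 1 dvd - half * (\<alpha> * (a + \<alpha> * b + \<beta> * d - (a - \<alpha> * b - \<beta> * d))
        + \<beta> * (\<beta> * b - c - \<alpha> * d + (\<beta> * b + c - \<alpha> * d))) - b"
      by (rule 1, rule trans[OF _ r[of b]]) (simp add: algebra_simps)
    show "2 * half - 1 dvd - half * (\<beta> * (a + \<alpha> * b + \<beta> * d - (a - \<alpha> * b - \<beta> * d))
        - \<alpha> * (\<beta> * b - c - \<alpha> * d + (\<beta> * b + c - \<alpha> * d))) - d"
      by (rule 1, rule trans[OF _ r[of d]]) (simp add: algebra_simps)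
  qed
qed

lemma to_mat_of_mat: "red (to_mat (of_mat x)) = red x"
proof -
  obtain a b c d where x: "x = (a, b, c, d)" by (cases x) auto
  obtain e where e: "\<alpha> * \<alpha> + \<beta> * \<beta> + 1 = (2 * half - 1) * e"
    using \<alpha>\<beta> P_eq by (auto simp: power2_eq_square)
  have 1: "2 * half - 1 dvd z" if "z = (2 * half - 1) * t" for z t using that by simp
  have r: "half * y - half * (\<alpha> * \<alpha> + \<beta> * \<beta>) * z - w = (2 * half - 1) * (w - half * e * z)"
    if "y + z = 2 * w" for y z w
  proof -
    have N: "\<alpha> * \<alpha> + \<beta> * \<beta> = (2 * half - 1) * e - 1" "y = 2 * w - z" using e that by simp_all
    show ?thesis unfolding N by (simp add: algebra_simps)
  qed
  show ?thesis
    unfolding x to_mat.simps of_mat.simps quat_mod_eq_iff P_eq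
    by (intro conjI)
      (rule 1, rule trans[OF _ r[of "a + d" "a - d" a]] trans[OF _ r[of "b - c" "b + c" b]]
          trans[OF _ r[of "c - b" "b + c" c]] trans[OF _ r[of "a + d" "d - a" d]],
        simp add: algebra_simps, simp; fail)+
qed

lemma to_mat_inject: "red (to_mat x) = red (to_mat y) \<longleftrightarrow> red x = red y"
  by (metis of_mat_to_mat red_of_mat_red red_to_mat_red)

lemma to_mat_eq_0_iff: "red (to_mat x) = (0, 0, 0, 0) \<longleftrightarrow> red x = (0, 0, 0, 0)"
  using to_mat_inject[of x "(0, 0, 0, 0)"] by simp

abbreviation "L \<equiv> lipschitz_ring p"

lemma carrier_iff: "x \<in> carrier L \<longleftrightarrow> red x = x"
proof -
  have "carrier (residue_ring P) = {0..<P}" by (auto simp: residue_ring_def)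
  moreover have "a \<in> {0..<P} \<longleftrightarrow> a mod P = a" for a
  proof
    assume "a mod P = a"
    then show "a \<in> {0..<P}" using P_ge_3 pos_mod_sign[of P a] pos_mod_bound[of P a] by auto
  qed simp
  ultimately show ?thesis by (cases x) (simp only: lipschitz_ring_def Let_def partial_object.simps mem_Times_iff fst_conv snd_conv quat_mod.simps prod.inject)
qed

lemma zero_L: "\<zero>\<^bsub>L\<^esub> = (0, 0, 0, 0)"
  by (simp add: lipschitz_ring_def)

lemma mult_eq_0_iff:
  "x \<otimes>\<^bsub>L\<^esub> y = \<zero>\<^bsub>L\<^esub> \<longleftrightarrow> red (mat2_mult (to_mat x) (to_mat y)) = (0, 0, 0, 0)"
  unfolding to_mat_mult[symmetric] to_mat_eq_0_iff by (simp add: lipschitz_ring_def)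

text \<open>
  The points of the projective line are numbered \<open>0, \<dots>, p\<close>, with \<open>p\<close> as the point at infinity.
  \<open>image_vec i\<close> spans the \<open>i\<close>-th line, and \<open>kernel_covec k\<close> is a linear form vanishing exactly on the
  \<open>k\<close>-th line. In each of them some coordinate is 1, which makes the scalar of a rank-one matrix unique.
\<close>

definition image_vec :: "int \<Rightarrow> int \<times> int" where
  "image_vec i = (if i = P then (0, 1) else (1, i))"

definition kernel_covec :: "int \<Rightarrow> int \<times> int" where
  "kernel_covec k = (if k = P then (1, 0) else (- k, 1))"

fun rank_one :: "int \<times> int \<times> int \<Rightarrow> quat" where
  "rank_one (k, i, s) = (case (image_vec i, kernel_covec k) of ((u, u'), (w, w')) \<Rightarrow>
     (s * (u * w), s * (u * w'), s * (u' * w), s * (u' * w')))"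

definition triples :: "(int \<times> int \<times> int) set" where
  "triples = {0..P} \<times> {0..P} \<times> {1..<P}"

definition zero_divisor_of :: "int \<times> int \<times> int \<Rightarrow> quat" where
  "zero_divisor_of x = red (of_mat (rank_one x))"

lemma to_mat_zero_divisor_of: "red (to_mat (zero_divisor_of x)) = red (rank_one x)"
  unfolding zero_divisor_of_def by (simp add: red_to_mat_red to_mat_of_mat)

lemma scalar_unit: "s \<in> {1..<P} \<Longrightarrow> \<not> P dvd s"
  using zdvd_not_zless by auto

lemma pairing_eq_0_iff:
  assumes "k \<in> {0..P}" "i \<in> {0..P}"
  shows "P dvd fst (kernel_covec k) * fst (image_vec i) + snd (kernel_covec k) * snd (image_vec i) \<longleftrightarrow> k = i"
proof -
  have "\<not> P dvd 1" using P_ge_3 by simp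
  moreover have "P dvd i - k \<longleftrightarrow> k = i" if "k < P" "i < P"
  proof
    assume "P dvd i - k"
    then have "i mod P = k mod P" by (simp add: mod_eq_dvd_iff)
    then show "k = i" using that assms by simp
  qed simp
  ultimately show ?thesis
    using assms by (auto simp: kernel_covec_def image_vec_def algebra_simps)
qed

text \<open>
  The product of two rank-one matrices is the value of the form of the first on the vector of the
  second, times a matrix of rank one; so it vanishes iff that value does.
\<close>

lemma zero_divisor_of_mult_eq_0_iff:
  assumes "(k, i, s) \<in> triples" "(k', i', s') \<in> triples"
  shows "zero_divisor_of (k, i, s) \<otimes>\<^bsub>L\<^esub> zero_divisor_of (k', i', s') = \<zero>\<^bsub>L\<^esub> \<longleftrightarrow> k = i'"
proof -
  obtain u v w x u' v' w' x' where
    uw: "image_vec i = (u, v)" "kernel_covec k = (w, x)"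
      "image_vec i' = (u', v')" "kernel_covec k' = (w', x')" by (metis surj_pair)
  let ?c = "w * u' + x * v'"
  have "zero_divisor_of (k, i, s) \<otimes>\<^bsub>L\<^esub> zero_divisor_of (k', i', s') = \<zero>\<^bsub>L\<^esub> \<longleftrightarrow>
      red (mat2_mult (rank_one (k, i, s)) (rank_one (k', i', s'))) = (0, 0, 0, 0)"
    unfolding mult_eq_0_iff
    by (subst (1 2) quat_mod_mat2_mult[symmetric]) (simp only: to_mat_zero_divisor_of)
  also have "mat2_mult (rank_one (k, i, s)) (rank_one (k', i', s')) =
      (s * s' * ?c * (u * w'), s * s' * ?c * (u * x'), s * s' * ?c * (v * w'), s * s' * ?c * (v * x'))"
    by (simp add: uw algebra_simps)
  also have "red \<dots> = (0, 0, 0, 0) \<longleftrightarrow> P dvd s * s' * ?c"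
    using uw by (auto simp: image_vec_def kernel_covec_def dvd_eq_mod_eq_0[symmetric] split: if_splits)
  also have "\<dots> \<longleftrightarrow> P dvd ?c"
    using assms P_prime scalar_unit[of s] scalar_unit[of s']
    by (auto simp: prime_dvd_mult_iff triples_def)
  also have "\<dots> \<longleftrightarrow> k = i'"
    using pairing_eq_0_iff[of k i'] assms uw by (auto simp: triples_def)
  finally show ?thesis .
qed

lemma zero_divisor_of_nonzero:
  assumes "x \<in> triples"
  shows "zero_divisor_of x \<noteq> \<zero>\<^bsub>L\<^esub>"
proof
  assume "zero_divisor_of x = \<zero>\<^bsub>L\<^esub>"
  then have *: "red (rank_one x) = (0, 0, 0, 0)"
    using to_mat_zero_divisor_of[of x] by (simp add: zero_L)
  obtain k i s where x: "x = (k, i, s)" "s \<in> {1..<P}" using assms by (auto simp: triples_def)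
  show False
    using * scalar_unit[OF x(2)] unfolding x(1)
    by (auto simp: image_vec_def kernel_covec_def dvd_eq_mod_eq_0[symmetric] split: if_splits)
qed

lemma zero_divisor_of_carrier: "zero_divisor_of x \<in> carrier L"
  by (simp add: carrier_iff zero_divisor_of_def quat_mod_mod)

text \<open>
  The kernel and the image of a matrix can be recovered from the rank-one matrices that it annihilates
  on either side.
\<close>

lemma inj_on_zero_divisor_of: "inj_on zero_divisor_of triples"
proof (rule inj_onI)
  fix x y assume xy: "x \<in> triples" "y \<in> triples" "zero_divisor_of x = zero_divisor_of y"
  obtain k i s k' i' s' where e: "x = (k, i, s)" "y = (k', i', s')" by (cases x; cases y) auto
  have "(i, k, s) \<in> triples" using xy(1) by (auto simp: e triples_def)
  from zero_divisor_of_mult_eq_0_iff[OF xy(1)[unfolded e(1)] this] zero_divisor_of_mult_eq_0_iff[OF xy(2)[unfolded e(2)] this]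
    zero_divisor_of_mult_eq_0_iff[OF this xy(1)[unfolded e(1)]] zero_divisor_of_mult_eq_0_iff[OF this xy(2)[unfolded e(2)]]
  have ki: "k' = k" "i' = i" using xy(3) unfolding e by auto
  have "red (rank_one (k, i, s)) = red (rank_one (k, i, s'))"
    using to_mat_zero_divisor_of[of x] to_mat_zero_divisor_of[of y] xy(3) unfolding e ki by simp
  then have "s mod P = s' mod P"
    by (auto simp: image_vec_def kernel_covec_def split: if_splits)
  then show "x = y" using xy(1,2) unfolding e ki by (simp add: triples_def)
qed

lemma inverse_mod_P:
  assumes "\<not> P dvd y"
  obtains v where "P dvd y * v - 1"
proof -
  have "coprime y P" using prime_imp_coprime[OF P_prime assms] by (simp add: coprime_commute)
  then obtain v where "[y * v = 1] (mod P)" using cong_solve_coprime_int by blast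
  then show ?thesis using that by (simp add: cong_iff_dvd_diff)
qed

lemma mod_in_points: "s mod P \<in> {0..P}" "s mod P \<noteq> P"
proof -
  have "0 < P" using P_ge_3 by linarith
  then have "0 \<le> s mod P" "s mod P < P" by (rule pos_mod_sign, rule pos_mod_bound)
  then show "s mod P \<in> {0..P}" "s mod P \<noteq> P"
    unfolding atLeastAtMost_iff by linarith+
qed

lemma mod_in_units: "\<not> P dvd s \<Longrightarrow> s mod P \<in> {1..<P}"
  using mod_in_points[of s] by (auto simp: dvd_eq_mod_eq_0)

lemma covector_normal_form:
  assumes "\<not> (P dvd x \<and> P dvd y)"
  shows "\<exists>k\<in>{0..P}. \<exists>s\<in>{1..<P}. P dvd s * fst (kernel_covec k) - x \<and> P dvd s * snd (kernel_covec k) - y"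
proof (cases "P dvd y")
  case True
  then have "\<not> P dvd x" using assms by simp
  then show ?thesis
    using True P_ge_3 mod_in_units[of x]
    by (intro bexI[of _ P] bexI[of _ "x mod P"]) (auto simp: kernel_covec_def mod_eq_dvd_iff[symmetric])
next
  case False
  obtain v where v: "P dvd y * v - 1" using False by (rule inverse_mod_P)
  let ?k = "(- x * v) mod P" and ?s = "y mod P"
  have s: "P dvd ?s - y" and k: "P dvd ?k + x * v"
    by (simp_all add: mod_eq_dvd_iff[symmetric] dvd_eq_mod_eq_0 mod_simps)
  have "?s * (- ?k) - x = - ?k * (?s - y) - y * (?k + x * v) + x * (y * v - 1)"
    by (simp add: algebra_simps)
  also have "P dvd \<dots>"
    by (intro dvd_add dvd_diff dvd_mult s k v)
  finally show ?thesis
    using s mod_in_points[of "- x * v"] mod_in_units[OF False]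
    by (intro bexI[of _ ?k] bexI[of _ ?s]) (simp_all add: kernel_covec_def)
qed

lemma proportional_rows:
  assumes "\<not> (P dvd a \<and> P dvd b)" "P dvd a * d - b * c"
  shows "\<exists>i\<in>{0..P}. i \<noteq> P \<and> P dvd i * a - c \<and> P dvd i * b - d"
proof (cases "P dvd a")
  case False
  obtain v where v: "P dvd a * v - 1" using False by (rule inverse_mod_P)
  let ?i = "(c * v) mod P"
  have i: "P dvd ?i - c * v" by (simp add: mod_eq_dvd_iff[symmetric])
  have "?i * a - c = a * (?i - c * v) + c * (a * v - 1)" by (simp add: algebra_simps)
  moreover have "?i * b - d = b * (?i - c * v) + d * (a * v - 1) - v * (a * d - b * c)"
    by (simp add: algebra_simps)
  moreover have "P dvd a * (?i - c * v) + c * (a * v - 1)"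
    "P dvd b * (?i - c * v) + d * (a * v - 1) - v * (a * d - b * c)"
    by (intro dvd_add dvd_diff dvd_mult i v assms(2))+
  ultimately show ?thesis using mod_in_points[of "c * v"] by (intro bexI[of _ ?i]) auto
next
  case True
  then have "\<not> P dvd b" using assms by simp
  then obtain v where v: "P dvd b * v - 1" by (rule inverse_mod_P)
  let ?i = "(d * v) mod P"
  have i: "P dvd ?i - d * v" by (simp add: mod_eq_dvd_iff[symmetric])
  have "?i * b - d = b * (?i - d * v) + d * (b * v - 1)" by (simp add: algebra_simps)
  moreover have "?i * a - c = a * (?i - d * v) + c * (b * v - 1) + v * (a * d - b * c)"
    by (simp add: algebra_simps)
  moreover have "P dvd b * (?i - d * v) + d * (b * v - 1)"
    "P dvd a * (?i - d * v) + c * (b * v - 1) + v * (a * d - b * c)"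
    by (intro dvd_add dvd_diff dvd_mult i v assms(2))+
  ultimately show ?thesis using mod_in_points[of "d * v"] by (intro bexI[of _ ?i]) auto
qed

text \<open>
  If the first row is nonzero, it is a multiple of a unique normalized form, and the second row is a
  multiple of the first because the determinant vanishes; otherwise the image is the point at infinity.
\<close>

lemma singular_is_rank_one:
  assumes "red (a, b, c, d) \<noteq> (0, 0, 0, 0)" "P dvd a * d - b * c"
  shows "\<exists>t\<in>triples. red (rank_one t) = red (a, b, c, d)"
proof (cases "P dvd a \<and> P dvd b")
  case True
  then have "\<not> (P dvd c \<and> P dvd d)" using assms(1) by auto
  from covector_normal_form[OF this] obtain k s where ks: "k \<in> {0..P}" "s \<in> {1..<P}"
    "P dvd s * fst (kernel_covec k) - c" "P dvd s * snd (kernel_covec k) - d" by blast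
  have "red (rank_one (k, P, s)) = red (a, b, c, d)"
    using ks True
    by (cases "kernel_covec k") (simp add: image_vec_def quat_mod_eq_iff del: quat_mod.simps)
  then show ?thesis using ks by (intro bexI[of _ "(k, P, s)"]) (simp_all add: triples_def)
next
  case False
  from covector_normal_form[OF this] obtain k s where ks: "k \<in> {0..P}" "s \<in> {1..<P}"
    "P dvd s * fst (kernel_covec k) - a" "P dvd s * snd (kernel_covec k) - b" by blast
  from proportional_rows[OF False assms(2)] obtain i where i: "i \<in> {0..P}" "i \<noteq> P"
    "P dvd i * a - c" "P dvd i * b - d" by blast
  have "P dvd s * (i * w) - z" if "P dvd s * w - y" "P dvd i * y - z" for w y z
  proof -
    have "s * (i * w) - z = i * (s * w - y) + (i * y - z)" by (simp add: algebra_simps)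
    also have "P dvd \<dots>" by (intro dvd_add dvd_mult that)
    finally show ?thesis .
  qed
  then have "red (rank_one (k, i, s)) = red (a, b, c, d)"
    using ks(3,4) i(2-4)
    by (cases "kernel_covec k") (simp add: image_vec_def quat_mod_eq_iff del: quat_mod.simps)
  then show ?thesis using ks i by (intro bexI[of _ "(k, i, s)"]) (simp_all add: triples_def)
qed

text \<open>
  Multiplication by the adjugate shows that the determinant annihilates the other factor.
\<close>

lemma zero_product_singular:
  assumes "red (mat2_mult (a, b, c, d) y) = (0, 0, 0, 0) \<or> red (mat2_mult y (a, b, c, d)) = (0, 0, 0, 0)"
    and "red y \<noteq> (0, 0, 0, 0)"
  shows "P dvd a * d - b * c"
proof (rule ccontr)
  assume n: "\<not> P dvd a * d - b * c"
  obtain e f g h where y: "y = (e, f, g, h)" by (cases y)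
  have cancel: "P dvd z" if "P dvd u" "P dvd v" "(a * d - b * c) * z = r * u + s * v" for z u v r s
  proof -
    have "P dvd (a * d - b * c) * z" unfolding that(3) using that(1,2) by simp
    then show ?thesis using n P_prime prime_dvd_mult_iff by blast
  qed
  have "P dvd e \<and> P dvd f \<and> P dvd g \<and> P dvd h"
    using assms(1)
  proof
    assume "red (mat2_mult (a, b, c, d) y) = (0, 0, 0, 0)"
    then have z: "P dvd a * e + b * g" "P dvd a * f + b * h" "P dvd c * e + d * g" "P dvd c * f + d * h"
      by (simp_all add: y dvd_eq_mod_eq_0)
    show ?thesis
      using cancel[OF z(1,3), of e d "- b"] cancel[OF z(2,4), of f d "- b"]
        cancel[OF z(1,3), of g "- c" a] cancel[OF z(2,4), of h "- c" a]
      by (simp add: algebra_simps)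
  next
    assume "red (mat2_mult y (a, b, c, d)) = (0, 0, 0, 0)"
    then have z: "P dvd e * a + f * c" "P dvd e * b + f * d" "P dvd g * a + h * c" "P dvd g * b + h * d"
      by (simp_all add: y dvd_eq_mod_eq_0)
    show ?thesis
      using cancel[OF z(1,2), of e d "- c"] cancel[OF z(1,2), of f "- b" a]
        cancel[OF z(3,4), of g d "- c"] cancel[OF z(3,4), of h "- b" a]
      by (simp add: algebra_simps)
  qed
  then show False using assms(2) by (simp add: y)
qed

lemma bij_betw_zero_divisor_of: "bij_betw zero_divisor_of triples (zero_divisors L)"
proof -
  have "zero_divisor_of x \<in> zero_divisors L" if x: "x \<in> triples" for x
  proof -
    obtain k i s where e: "x = (k, i, s)" by (cases x)
    have y: "(i, k, s) \<in> triples" using x by (auto simp: e triples_def)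
    then have "zero_divisor_of x \<otimes>\<^bsub>L\<^esub> zero_divisor_of (i, k, s) = \<zero>\<^bsub>L\<^esub>" using x zero_divisor_of_mult_eq_0_iff unfolding e by blast
    then show ?thesis
      using zero_divisor_of_carrier zero_divisor_of_nonzero[OF x] zero_divisor_of_nonzero[OF y] unfolding zero_divisors_def by blast
  qed
  moreover have "x \<in> zero_divisor_of ` triples" if xz: "x \<in> zero_divisors L" for x
  proof -
    obtain y where x: "red x = x" "x \<noteq> (0, 0, 0, 0)" and y: "red y = y" "y \<noteq> (0, 0, 0, 0)"
      and xy: "x \<otimes>\<^bsub>L\<^esub> y = \<zero>\<^bsub>L\<^esub> \<or> y \<otimes>\<^bsub>L\<^esub> x = \<zero>\<^bsub>L\<^esub>"
    proof -
      obtain y where "x \<in> carrier L" "x \<noteq> \<zero>\<^bsub>L\<^esub>" "y \<in> carrier L" "y \<noteq> \<zero>\<^bsub>L\<^esub>"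
        "x \<otimes>\<^bsub>L\<^esub> y = \<zero>\<^bsub>L\<^esub> \<or> y \<otimes>\<^bsub>L\<^esub> x = \<zero>\<^bsub>L\<^esub>"
        using xz unfolding zero_divisors_def by blast
      then show ?thesis by (intro that[of y]) (simp_all only: carrier_iff zero_L, simp_all)
    qed
    obtain a b c d where m: "to_mat x = (a, b, c, d)" by (cases "to_mat x")
    have nz: "red (to_mat x) \<noteq> (0, 0, 0, 0)" "red (to_mat y) \<noteq> (0, 0, 0, 0)"
      using x y by (simp_all add: to_mat_eq_0_iff)
    have "P dvd a * d - b * c"
      using zero_product_singular[of a b c d "to_mat y"] xy nz(2) by (simp add: mult_eq_0_iff m)
    from singular_is_rank_one[OF _ this] obtain t where t: "t \<in> triples" "red (rank_one t) = red (to_mat x)"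
      using nz(1) m by auto
    have "red (to_mat (zero_divisor_of t)) = red (to_mat x)" using t(2) by (simp add: to_mat_zero_divisor_of)
    then have "zero_divisor_of t = x" using x(1) by (simp add: to_mat_inject) (simp add: zero_divisor_of_def quat_mod_mod)
    then show ?thesis using t(1) by blast
  qed
  ultimately show ?thesis using inj_on_zero_divisor_of unfolding bij_betw_def by blast
qed

end

section \<open>The energy and its growth\<close>

theorem graph_energy_zero_divisor_graph:
  assumes "prime p" "odd p"
  shows "graph_energy (zero_divisor_graph (lipschitz_ring p)) =
    2 * real p ^ 3 - 2 * real p ^ 2 - real p - 1
    + sqrt (4 * real p ^ 4 - 4 * real p ^ 2 - 8 * real p + 9)
    + real p * sqrt (real p ^ 4 - 8 * real p + 8)"
proof -
  obtain \<alpha> \<beta> where "int p dvd \<alpha>\<^sup>2 + \<beta>\<^sup>2 + 1"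
    using sum_two_squares_cong_minus_one[OF assms] by blast
  then interpret Q: split_quaternions p \<alpha> \<beta>
    using assms by unfold_locales
  interpret I: incidence_pattern "{0..int p}" "{1..<int p}" p
    using Q.P_ge_3 by unfold_locales auto
  let ?G = "zero_divisor_graph (lipschitz_ring p)"
  let ?c = "\<lambda>z. if fst z = fst (snd z) then I.nilpotent_value else I.regular_value"
  have J: "I.J = Q.triples" by (simp add: I.J_def Q.triples_def)
  have fin: "finite I.J" by (simp add: I.J_def)
  have bij: "bij_betw Q.zero_divisor_of I.J (pverts ?G)"
    using Q.bij_betw_zero_divisor_of by (simp add: J zero_divisor_graph_def)
  have arcs: "I.meets x y \<longleftrightarrow> (Q.zero_divisor_of x, Q.zero_divisor_of y) \<in> parcs ?G" if "x \<in> I.J" "y \<in> I.J" for x y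
  proof -
    have "Q.zero_divisor_of x \<in> zero_divisors Q.L" "Q.zero_divisor_of y \<in> zero_divisors Q.L"
      using Q.bij_betw_zero_divisor_of that by (auto simp: J bij_betw_def)
    moreover have "Q.zero_divisor_of x = Q.zero_divisor_of y \<longleftrightarrow> x = y"
      using Q.inj_on_zero_divisor_of that by (simp add: J inj_on_eq_iff)
    moreover have "Q.zero_divisor_of x \<otimes>\<^bsub>Q.L\<^esub> Q.zero_divisor_of y = \<zero>\<^bsub>Q.L\<^esub> \<longleftrightarrow> fst x = fst (snd y)"
      "Q.zero_divisor_of y \<otimes>\<^bsub>Q.L\<^esub> Q.zero_divisor_of x = \<zero>\<^bsub>Q.L\<^esub> \<longleftrightarrow> fst y = fst (snd x)"
      using that Q.zero_divisor_of_mult_eq_0_iff unfolding J by (cases x; cases y; simp)+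
    ultimately show ?thesis unfolding I.meets_def zero_divisor_graph_def by auto
  qed
  have "abs_at I.J I.meets z (\<lambda>x. of_bool (x = z)) (?c z)" if "z \<in> I.J" for z
    using that I.abs_at_nilpotent I.abs_at_regular
    by (cases z) (auto simp: I.J_def)
  from graph_energy_eq_sum_abs_at[OF fin bij arcs this] show ?thesis
    using I.total_abs_value by simp
qed

text \<open>
  The first radical lies between \<open>0\<close> and \<open>2 x\<^sup>2\<close>, the second between \<open>x\<^sup>2 - x\<close> and \<open>x\<^sup>2\<close>; so the cubic
  terms are \<open>2 x\<^sup>3\<close> and one further \<open>x\<^sup>3\<close> from the second radical.
\<close>

lemma energy_formula_near_cube:
  assumes "x \<ge> (3 :: real)"
  shows "\<bar>2 * x ^ 3 - 2 * x ^ 2 - x - 1 + sqrt (4 * x ^ 4 - 4 * x ^ 2 - 8 * x + 9)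
    + x * sqrt (x ^ 4 - 8 * x + 8) - 3 * x ^ 3\<bar> \<le> 7 * x\<^sup>2"
proof -
  have x2: "x\<^sup>2 \<ge> 3 * x" using mult_right_mono[OF assms, of x] assms by (simp add: power2_eq_square)
  have x3: "x ^ 3 \<ge> 3 * x\<^sup>2"
    using mult_right_mono[OF assms, of "x\<^sup>2"] by (simp add: power2_eq_square power3_eq_cube)
  have x4: "x ^ 4 \<ge> 3 * x ^ 3"
    using mult_right_mono[OF assms, of "x ^ 3"] assms by (simp add: power3_eq_cube power4_eq_xxxx)
  have sq: "(2 * x\<^sup>2)\<^sup>2 = 4 * x ^ 4" "(x\<^sup>2)\<^sup>2 = x ^ 4" "(x\<^sup>2 - x)\<^sup>2 = x ^ 4 - 2 * x ^ 3 + x\<^sup>2"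
    by (simp_all add: power2_eq_square power3_eq_cube power4_eq_xxxx algebra_simps)
  let ?A = "sqrt (4 * x ^ 4 - 4 * x ^ 2 - 8 * x + 9)" and ?B = "sqrt (x ^ 4 - 8 * x + 8)"
  have A: "0 \<le> ?A" "?A \<le> 2 * x\<^sup>2"
    using x2 x3 x4 assms sq by (auto intro!: real_le_lsqrt simp del: power2_le_iff_abs_le)
  have "?B \<le> x\<^sup>2" using assms sq by (intro real_le_lsqrt) auto
  moreover have "x\<^sup>2 - x \<le> ?B" using x2 x3 assms sq by (intro real_le_rsqrt) auto
  ultimately have "x * ?B \<le> x * x\<^sup>2" "x * (x\<^sup>2 - x) \<le> x * ?B"
    using assms by (auto intro!: mult_left_mono)
  then have "x * ?B \<le> x ^ 3" "x ^ 3 - x\<^sup>2 \<le> x * ?B"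
    by (simp_all add: power2_eq_square power3_eq_cube algebra_simps)
  then show ?thesis using A x2 assms by linarith
qed

theorem theorem7p3:
  shows "(\<forall>p :: nat. prime p \<and> odd p \<longrightarrow>
            graph_energy (zero_divisor_graph (lipschitz_ring p)) =
              2 * real p ^ 3 - 2 * real p ^ 2 - real p - 1
              + sqrt (4 * real p ^ 4 - 4 * real p ^ 2 - 8 * real p + 9)
              + real p * sqrt (real p ^ 4 - 8 * real p + 8))
         \<and> (\<lambda>p :: nat. graph_energy (zero_divisor_graph (lipschitz_ring p)) - 3 * real p ^ 3)
             \<in> O[inf at_top (principal {p. prime p \<and> odd p})](\<lambda>p. real p ^ 2)"
proof (intro conjI allI impI)
  show "(\<lambda>p :: nat. graph_energy (zero_divisor_graph (lipschitz_ring p)) - 3 * real p ^ 3)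
    \<in> O[inf at_top (principal {p. prime p \<and> odd p})](\<lambda>p. real p ^ 2)"
  proof (rule bigoI[where c = 7], unfold eventually_inf_principal, intro always_eventually allI impI)
    fix p :: nat assume p: "p \<in> {p. prime p \<and> odd p}"
    then have "p \<noteq> 2" by auto
    then have "real p \<ge> 3" using p prime_ge_2_nat[of p] by auto
    from energy_formula_near_cube[OF this]
    show "norm (graph_energy (zero_divisor_graph (lipschitz_ring p)) - 3 * real p ^ 3) \<le> 7 * norm (real p ^ 2)"
      using p graph_energy_zero_divisor_graph by simp
  qed
qed (use graph_energy_zero_divisor_graph in blast)

end
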